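(* Let $m=1$, $A\in\mathbb{R}^{n\times n}$, $B\in\mathbb{R}^{n\times 1}$ with $(A,B)$ controllable, let $T>0$, and let $G(t)$, $\tilde A,H,N,f$ be as in the context. There exist a constant $Q\in\mathbb{R}^{n\times n}$ and a function $Y:[0,T]\to\mathbb{R}^{n\times n}$ satisfying, for all $t\in[0,T]$, $$\dot Y(t)=-A^TY(t)-Y(t)A-Q-G(t),\qquad B^TY(t)=0,$$ if and only if there exists $q_v\in\mathbb{R}^{n^2}$ satisfying, for all $t\in[0,T]$, $$(H\tilde A^TH^{-1}N+H)\,q_v=-H\tilde A^TH^{-1}f(\mathrm{vec}(G))+\dot f(\mathrm{vec}(G))-H\,\mathrm{vec}(G).$$ If the latter holds for $q_v$, then a solution $Q$ and the unique corresponding $Y(t)$ are given by $$Q=\mathrm{mat}(q_v),\qquad Y(t)=-\mathrm{mat}\big(H^{-1}(Nq_v+f(\mathrm{vec}(G)))\big).$$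
   Context: $\otimes$ is the Kronecker product, $\mathrm{vec}$ stacks columns, $\mathrm{mat}:\mathbb{R}^{n^2}\to\mathbb{R}^{n\times n}$ is the inverse of $\mathrm{vec}$, $X^\dagger$ is the Moore-Penrose inverse. Data: $K(t)\in\mathbb{R}^{m\times n}$, $t\in[0,T]$, is such that $K(t)B$ is symmetric and $\mathrm{rank}(K(t)B)=\mathrm{rank}(K(t))$ for all $t$. Put $P_0(t)=-K^T(t)(K(t)B)^\dagger K(t)$ and $G(t)=\dot P_0+A^TP_0+P_0A-P_0BB^TP_0$. It is assumed that $P_0$ is $n$ times continuously differentiable on $[0,T]$, so that $G$ is $n-1$ times continuously differentiable. Notation: $\tilde A=-I_n\otimes A-A\otimes I_n$, $\tilde B=I_n\otimes B$; $$H=\begin{bmatrix}\tilde B^T\\ \tilde B^T\tilde A^T\\ \vdots\\ \tilde B^T(\tilde A^T)^{n-1}\end{bmatrix},\qquad N=\begin{bmatrix}0\\ -\tilde B^T\\ -\tilde B^T\tilde A^T\\ \vdots\\ -\tilde B^T(\tilde A^T)^{n-2}\end{bmatrix},$$ and $f(\mathrm{vec}(G))=f(\mathrm{vec}(G))(t)$ is the vector with $n$ blocks, whose block number $k$ ($k=0,\dots,n-1$) is $-\sum_{i=0}^{k-1}\tilde B^T(\tilde A^T)^{k-1-i}\mathrm{vec}(G^{(i)}(t))$ (block $0$ is zero), $G^{(i)}$ denoting the $i$-th time derivative. For $m=1$ and $(A,B)$ controllable, $H$ is square and invertible. $\dot f(\mathrm{vec}(G))$ is the time derivative of $f(\mathrm{vec}(G))(t)$.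 *)

theory Defs
  imports
    "HOL-Analysis.Derivative"
    "Jordan_Normal_Form.Gauss_Jordan_Elimination"
    "Jordan_Normal_Form.DL_Rank"
begin

unbundle no vec_syntax
no_notation Inner_Product.real_inner_class.inner (infixl \<open>\<bullet>\<close> 70)
hide_const (open) Finite_Cartesian_Product.vec Finite_Cartesian_Product.mat
  Finite_Cartesian_Product.transpose Finite_Cartesian_Product.row
  Finite_Cartesian_Product.column

section \<open>Matrix algebra\<close>

definition kronecker :: "real mat \<Rightarrow> real mat \<Rightarrow> real mat" (infixl \<open>\<otimes>\<^sub>K\<close> 70) where
  "X \<otimes>\<^sub>K Z = mat (dim_row X * dim_row Z) (dim_col X * dim_col Z)
     (\<lambda>(i, j). X $$ (i div dim_row Z, j div dim_col Z) * Z $$ (i mod dim_row Z, j mod dim_col Z))"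

text \<open>Column stacking, and its inverse on vectors of length \<open>n\<^sup>2\<close>.\<close>

definition vec_of_cols :: "real mat \<Rightarrow> real vec" where
  "vec_of_cols X = vec (dim_row X * dim_col X) (\<lambda>l. X $$ (l mod dim_row X, l div dim_row X))"

definition mat_of_vec :: "nat \<Rightarrow> real vec \<Rightarrow> real mat" where
  "mat_of_vec n v = mat n n (\<lambda>(i, j). v $ (j * n + i))"

text \<open>The Moore-Penrose inverse, as the unique solution of the four Penrose equations.\<close>

definition is_pinv :: "real mat \<Rightarrow> real mat \<Rightarrow> bool" where
  "is_pinv X Z \<longleftrightarrow> Z \<in> carrier_mat (dim_col X) (dim_row X)
     \<and> X * Z * X = X \<and> Z * X * Z = Z
     \<and> transpose_mat (X * Z) = X * Z \<and> transpose_mat (Z * X) = Z * X"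

definition pinv :: "real mat \<Rightarrow> real mat" where
  "pinv X = (THE Z. is_pinv X Z)"

text \<open>The inverse of a square matrix; unspecified when the matrix is singular.\<close>

definition mat_inv :: "real mat \<Rightarrow> real mat" where
  "mat_inv X = the (mat_inverse X)"

text \<open>\<open>vec_space.rank n\<close> is the rank of a matrix with \<open>n\<close> rows.\<close>

definition mat_rank :: "real mat \<Rightarrow> nat" where
  "mat_rank X = vec_space.rank (dim_row X) X"

text \<open>Kalman's rank condition for \<open>[B, A B, \<dots>, A\<^sup>n\<^sup>-\<^sup>1 B]\<close>.\<close>

definition controllability_matrix :: "real mat \<Rightarrow> real mat \<Rightarrow> real mat" where
  "controllability_matrix A B = mat (dim_row A) (dim_row A * dim_col B)
     (\<lambda>(i, j). (A ^\<^sub>m (j div dim_col B) * B) $$ (i, j mod dim_col B))"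

definition controllable :: "real mat \<Rightarrow> real mat \<Rightarrow> bool" where
  "controllable A B \<longleftrightarrow> mat_rank (controllability_matrix A B) = dim_row A"

section \<open>Calculus of matrix functions on a compact time interval\<close>

text \<open>
  All derivatives are taken within \<open>[0, T]\<close>, hence are one-sided at the end points, and
  depend only on the values of the function on \<open>[0, T]\<close>.
\<close>

definition has_mat_deriv :: "real \<Rightarrow> (real \<Rightarrow> real mat) \<Rightarrow> real mat \<Rightarrow> real \<Rightarrow> bool" where
  "has_mat_deriv T F D t \<longleftrightarrow> dim_row D = dim_row (F t) \<and> dim_col D = dim_col (F t) \<and>
     (\<forall>i < dim_row D. \<forall>j < dim_col D.
        ((\<lambda>s. F s $$ (i, j)) has_real_derivative D $$ (i, j)) (at t within {0..T}))"

definition mat_deriv :: "real \<Rightarrow> (real \<Rightarrow> real mat) \<Rightarrow> real \<Rightarrow> real mat" where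
  "mat_deriv T F t = mat (dim_row (F t)) (dim_col (F t))
     (\<lambda>(i, j). vector_derivative (\<lambda>s. F s $$ (i, j)) (at t within {0..T}))"

definition vec_deriv :: "real \<Rightarrow> (real \<Rightarrow> real vec) \<Rightarrow> real \<Rightarrow> real vec" where
  "vec_deriv T u t = vec (dim_vec (u t))
     (\<lambda>i. vector_derivative (\<lambda>s. u s $ i) (at t within {0..T}))"

text \<open>\<open>F\<close>, with values in the \<open>p \<times> q\<close> matrices, is \<open>k\<close> times continuously differentiable.\<close>

definition mat_C_k :: "real \<Rightarrow> nat \<Rightarrow> nat \<Rightarrow> nat \<Rightarrow> (real \<Rightarrow> real mat) \<Rightarrow> bool" where
  "mat_C_k T k p q F \<longleftrightarrow> (\<forall>t\<in>{0..T}. F t \<in> carrier_mat p q) \<and>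
     (\<forall>l < k. \<forall>t\<in>{0..T}. has_mat_deriv T ((mat_deriv T ^^ l) F) ((mat_deriv T ^^ Suc l) F t) t) \<and>
     (\<forall>i < p. \<forall>j < q. continuous_on {0..T} (\<lambda>t. (mat_deriv T ^^ k) F t $$ (i, j)))"

section \<open>The data of the problem\<close>

definition P0 :: "real mat \<Rightarrow> (real \<Rightarrow> real mat) \<Rightarrow> real \<Rightarrow> real mat" where
  "P0 B K t = - (transpose_mat (K t) * pinv (K t * B) * K t)"

definition G :: "real \<Rightarrow> real mat \<Rightarrow> real mat \<Rightarrow> (real \<Rightarrow> real mat) \<Rightarrow> real \<Rightarrow> real mat" where
  "G T A B K t = mat_deriv T (P0 B K) t + transpose_mat A * P0 B K t + P0 B K t * A
     - P0 B K t * B * transpose_mat B * P0 B K t"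

definition A_tilde :: "real mat \<Rightarrow> real mat" where
  "A_tilde A = - (1\<^sub>m (dim_row A) \<otimes>\<^sub>K A) - A \<otimes>\<^sub>K 1\<^sub>m (dim_row A)"

definition B_tilde :: "real mat \<Rightarrow> real mat" where
  "B_tilde B = 1\<^sub>m (dim_row B) \<otimes>\<^sub>K B"

text \<open>\<open>obs_block A B k\<close> is the product of the transpose of \<open>B_tilde B\<close> with the \<open>k\<close>-th power
  of the transpose of \<open>A_tilde A\<close>.\<close>

definition obs_block :: "real mat \<Rightarrow> real mat \<Rightarrow> nat \<Rightarrow> real mat" where
  "obs_block A B k = transpose_mat (B_tilde B) * transpose_mat (A_tilde A) ^\<^sub>m k"

text \<open>Vertical stacking of \<open>b\<close> blocks, numbered from 0, of \<open>p\<close> rows each.\<close>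

definition stack_mat :: "nat \<Rightarrow> nat \<Rightarrow> nat \<Rightarrow> (nat \<Rightarrow> real mat) \<Rightarrow> real mat" where
  "stack_mat b p q F = mat (b * p) q (\<lambda>(i, j). F (i div p) $$ (i mod p, j))"

definition stack_vec :: "nat \<Rightarrow> nat \<Rightarrow> (nat \<Rightarrow> real vec) \<Rightarrow> real vec" where
  "stack_vec b p u = vec (b * p) (\<lambda>i. u (i div p) $ (i mod p))"

definition H_mat :: "real mat \<Rightarrow> real mat \<Rightarrow> real mat" where
  "H_mat A B = (let n = dim_row A; p = n * dim_col B in stack_mat n p (n * n) (obs_block A B))"

definition N_mat :: "real mat \<Rightarrow> real mat \<Rightarrow> real mat" where
  "N_mat A B = (let n = dim_row A; p = n * dim_col B in
     stack_mat n p (n * n) (\<lambda>k. if k = 0 then 0\<^sub>m p (n * n) else - obs_block A B (k - 1)))"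

text \<open>\<open>f_vec T A B F t\<close> is \<open>f(vec(F))(t)\<close>; the sum of vectors is written entrywise.\<close>

definition f_vec ::
  "real \<Rightarrow> real mat \<Rightarrow> real mat \<Rightarrow> (real \<Rightarrow> real mat) \<Rightarrow> real \<Rightarrow> real vec" where
  "f_vec T A B F t = (let n = dim_row A; p = n * dim_col B in
     stack_vec n p (\<lambda>k. vec p (\<lambda>r.
       - (\<Sum>i<k. (obs_block A B (k - 1 - i) *\<^sub>v vec_of_cols ((mat_deriv T ^^ i) F t)) $ r))))"

definition solves :: "real \<Rightarrow> real mat \<Rightarrow> real mat \<Rightarrow> (real \<Rightarrow> real mat) \<Rightarrow>
    real mat \<Rightarrow> (real \<Rightarrow> real mat) \<Rightarrow> bool" where
  "solves T A B F Q Y \<longleftrightarrow> (\<forall>t\<in>{0..T}.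
     Y t \<in> carrier_mat (dim_row A) (dim_row A) \<and>
     has_mat_deriv T Y (- (transpose_mat A * Y t) - Y t * A - Q - F t) t \<and>
     transpose_mat B * Y t = 0\<^sub>m (dim_col B) (dim_row A))"

definition q_equation ::
  "real \<Rightarrow> real mat \<Rightarrow> real mat \<Rightarrow> (real \<Rightarrow> real mat) \<Rightarrow> real vec \<Rightarrow> bool" where
  "q_equation T A B F q \<longleftrightarrow>
     (let At = transpose_mat (A_tilde A); H = H_mat A B; N = N_mat A B; f = f_vec T A B F in
      \<forall>t\<in>{0..T}. (H * At * mat_inv H * N + H) *\<^sub>v q
        = - ((H * At * mat_inv H) *\<^sub>v f t) + vec_deriv T f t - H *\<^sub>v vec_of_cols (F t))"

end

theory Submission
  imports Defs
begin

text \<open>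
  In vectorised form the problem reads \<open>y' = M y - q - g\<close>, \<open>C y = 0\<close>, where \<open>M\<close> and \<open>C\<close> are the
  transposes of \<open>A_tilde A\<close> and \<open>B_tilde B\<close>. Differentiating \<open>C y = 0\<close> up to \<open>n - 1\<close> times yields
  \<open>H y = - (N q + f)\<close>. For a controllable pair with a single input \<open>H\<close> is invertible, so \<open>y\<close> is
  determined by \<open>q\<close>, and for this \<open>y\<close> the differential equation, multiplied by \<open>H\<close>, is the equation
  for \<open>q\<close>. Conversely, block 0 of \<open>H y = - (N q + f)\<close> is \<open>C y = 0\<close>.

  \<open>H\<close> is injective because, with \<open>L Y = - (A\<^sup>T Y) - Y A\<close>, the rule
  \<open>B\<^sup>T (A\<^sup>T)\<^sup>j\<^sup>+\<^sup>1 Y = - (B\<^sup>T (A\<^sup>T)\<^sup>j L Y) - B\<^sup>T (A\<^sup>T)\<^sup>j Y A\<close> turns \<open>B\<^sup>T L\<^sup>k Y = 0\<close> for all \<open>k < n\<close>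
  into \<open>B\<^sup>T (A\<^sup>T)\<^sup>k Y = 0\<close> for all \<open>k < n\<close>, that is, the transposed Kalman matrix annihilates \<open>Y\<close>.
\<close>

section \<open>Continuously differentiable matrix functions\<close>

text \<open>Matrix functions are constrained on \<open>{0..T}\<close> only; elsewhere even their
  dimensions are arbitrary, so entrywise identities are available just inside the interval. A
  derivative within \<open>S\<close> at a point of \<open>S\<close> sees nothing else.\<close>

lemma has_real_derivative_within_cong:
  fixes f g :: "real \<Rightarrow> real"
  assumes "(g has_real_derivative d) (at t within S)" "t \<in> S" "\<And>s. s \<in> S \<Longrightarrow> f s = g s"
  shows "(f has_real_derivative d) (at t within S)"
  using assms by (metis has_field_derivative_def has_derivative_transform)

lemma index_mult_mat_sum:
  assumes "X \<in> carrier_mat p q" "Z \<in> carrier_mat q r" "i < p" "j < r"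
  shows "(X * Z) $$ (i, j) = (\<Sum>l<q. X $$ (i, l) * Z $$ (l, j))"
  using assms by (auto simp: scalar_prod_def lessThan_atLeast0 intro!: sum.cong)

lemma index_mult_mat_vec_sum:
  assumes "X \<in> carrier_mat p q" "v \<in> carrier_vec q" "i < p"
  shows "(X *\<^sub>v v) $ i = (\<Sum>l<q. X $$ (i, l) * v $ l)"
  using assms by (auto simp: scalar_prod_def lessThan_atLeast0 intro!: sum.cong)

lemma mat_deriv_cong:
  assumes "\<And>s. s \<in> {0..T} \<Longrightarrow> F s = F' s" "t \<in> {0..T}"
  shows "mat_deriv T F t = mat_deriv T F' t"
proof -
  have "vector_derivative (\<lambda>s. F s $$ ij) (at t within {0..T})
      = vector_derivative (\<lambda>s. F' s $$ ij) (at t within {0..T})" for ij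
  proof (rule vector_derivative_cong_eq)
    show "\<forall>\<^sub>F s in nhds t. s \<in> {0..T} \<longrightarrow> F s $$ ij = F' s $$ ij"
      using assms(1) by (intro always_eventually) simp
  qed (use assms(2) in simp_all)
  with assms show ?thesis
    by (simp add: mat_deriv_def)
qed

lemma has_mat_deriv_cong:
  assumes "has_mat_deriv T F' D t" "\<And>s. s \<in> {0..T} \<Longrightarrow> F s = F' s" "t \<in> {0..T}"
  shows "has_mat_deriv T F D t"
proof -
  have "((\<lambda>s. F s $$ (i, j)) has_real_derivative D $$ (i, j)) (at t within {0..T})"
    if "((\<lambda>s. F' s $$ (i, j)) has_real_derivative D $$ (i, j)) (at t within {0..T})" for i j
    using that assms(3) by (rule has_real_derivative_within_cong) (simp only: assms(2))
  with assms(1) show ?thesis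
    unfolding has_mat_deriv_def assms(2)[OF assms(3)] by simp
qed

text \<open>The derivative within a nondegenerate interval is unique, also at the end points; this
  is where \<open>T > 0\<close> enters.\<close>

lemma has_mat_deriv_imp_mat_deriv:
  assumes "has_mat_deriv T F D t" "t \<in> {0..T}" "T > 0"
  shows "mat_deriv T F t = D"
  using assms unfolding has_mat_deriv_def mat_deriv_def
  by (auto intro!: eq_matI vector_derivative_within_closed_interval
      simp: has_real_derivative_iff_has_vector_derivative)

lemma mat_C_k_0:
  "mat_C_k T 0 p q F \<longleftrightarrow> (\<forall>t\<in>{0..T}. F t \<in> carrier_mat p q) \<and>
     (\<forall>i < p. \<forall>j < q. continuous_on {0..T} (\<lambda>t. F t $$ (i, j)))"
  by (simp add: mat_C_k_def)

text \<open>Peels off the innermost derivative instead of the outermost. Smoothness becomes a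
  recursion on \<open>k\<close> with a varying function, the form on which the inductions over the
  order rest.\<close>

lemma mat_C_k_Suc:
  "mat_C_k T (Suc k) p q F \<longleftrightarrow> (\<forall>t\<in>{0..T}. F t \<in> carrier_mat p q) \<and>
     (\<forall>t\<in>{0..T}. has_mat_deriv T F (mat_deriv T F t) t) \<and> mat_C_k T k p q (mat_deriv T F)"
proof -
  have *: "mat_deriv T ((mat_deriv T ^^ l) F) = (mat_deriv T ^^ l) (mat_deriv T F)" for l
    by (simp add: funpow_swap1)
  show ?thesis
    unfolding mat_C_k_def by (auto simp: All_less_Suc2 * mat_deriv_def[of T F])
qed

lemma mat_C_k_carrier: "mat_C_k T k p q F \<Longrightarrow> t \<in> {0..T} \<Longrightarrow> F t \<in> carrier_mat p q"
  by (simp add: mat_C_k_def)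

lemma mat_C_k_cong:
  assumes "mat_C_k T k p q F'" "\<And>s. s \<in> {0..T} \<Longrightarrow> F s = F' s"
  shows "mat_C_k T k p q F"
  using assms
proof (induction k arbitrary: F F')
  case 0
  have "continuous_on {0..T} (\<lambda>t. F t $$ (i, j))" if "i < p" "j < q" for i j
  proof (rule continuous_on_eq)
    show "continuous_on {0..T} (\<lambda>t. F' t $$ (i, j))"
      using 0 that by (simp add: mat_C_k_0)
  qed (use 0 in simp)
  with 0 show ?case by (simp add: mat_C_k_0)
next
  case (Suc k)
  have eq: "mat_deriv T F t = mat_deriv T F' t" if "t \<in> {0..T}" for t
    using Suc.prems(2) that by (rule mat_deriv_cong)
  have "has_mat_deriv T F (mat_deriv T F t) t" if "t \<in> {0..T}" for t
    unfolding eq[OF that]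
  proof (rule has_mat_deriv_cong)
    show "has_mat_deriv T F' (mat_deriv T F' t) t"
      using Suc.prems(1) that by (simp add: mat_C_k_Suc)
  qed (use Suc.prems(2) that in simp_all)
  moreover have "mat_C_k T k p q (mat_deriv T F)"
  proof (rule Suc.IH)
    show "mat_C_k T k p q (mat_deriv T F')"
      using Suc.prems(1) by (simp add: mat_C_k_Suc)
  qed (rule eq)
  ultimately show ?case
    using Suc.prems by (simp add: mat_C_k_Suc)
qed

text \<open>Any candidate \<open>D\<close> may be supplied: by uniqueness it agrees with
  \<open>mat_deriv T F\<close> on the interval, and smoothness transfers by congruence. The closure
  rules then only have to exhibit a derivative.\<close>

lemma mat_C_k_SucI:
  assumes "\<And>t. t \<in> {0..T} \<Longrightarrow> F t \<in> carrier_mat p q"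
    and "\<And>t. t \<in> {0..T} \<Longrightarrow> has_mat_deriv T F (D t) t"
    and "mat_C_k T k p q D" "T > 0"
  shows "mat_C_k T (Suc k) p q F"
proof -
  have eq: "mat_deriv T F t = D t" if "t \<in> {0..T}" for t
    using assms(2)[OF that] that assms(4) by (rule has_mat_deriv_imp_mat_deriv)
  have "mat_C_k T k p q (mat_deriv T F)"
    using assms(3) eq by (rule mat_C_k_cong)
  with assms eq show ?thesis by (simp add: mat_C_k_Suc)
qed

text \<open>Only the passage from order one to order zero needs an argument, namely that
  differentiability implies continuity; higher orders reduce to the derivative.\<close>

lemma mat_C_k_SucD: "mat_C_k T (Suc k) p q F \<Longrightarrow> mat_C_k T k p q F"
proof (induction k arbitrary: F)
  case 0
  have "continuous_on {0..T} (\<lambda>t. F t $$ (i, j))" if "i < p" "j < q" for i j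
  proof (rule DERIV_continuous_on)
    fix t assume "t \<in> {0..T}"
    with 0 that show "((\<lambda>t. F t $$ (i, j)) has_real_derivative mat_deriv T F t $$ (i, j))
        (at t within {0..T})"
      unfolding mat_C_k_Suc has_mat_deriv_def by fastforce
  qed
  with 0 show ?case by (simp add: mat_C_k_Suc mat_C_k_0)
next
  case (Suc k)
  then show ?case by (metis mat_C_k_Suc)
qed

lemma mat_C_k_const: "M \<in> carrier_mat p q \<Longrightarrow> T > 0 \<Longrightarrow> mat_C_k T k p q (\<lambda>t. M)"
proof (induction k arbitrary: M)
  case 0
  then show ?case by (simp add: mat_C_k_0)
next
  case (Suc k)
  show ?case
  proof (rule mat_C_k_SucI)
    show "has_mat_deriv T (\<lambda>t. M) (0\<^sub>m p q) t" for t
      using Suc by (auto simp: has_mat_deriv_def)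
    show "mat_C_k T k p q (\<lambda>t. 0\<^sub>m p q)"
      using Suc by auto
  qed (use Suc in auto)
qed

section \<open>Sum, difference and product rules, and closure of the smoothness classes\<close>

lemma has_mat_deriv_add:
  assumes "has_mat_deriv T F F' t" "has_mat_deriv T E E' t" "t \<in> {0..T}"
    and "\<And>s. s \<in> {0..T} \<Longrightarrow> F s \<in> carrier_mat p q" "\<And>s. s \<in> {0..T} \<Longrightarrow> E s \<in> carrier_mat p q"
  shows "has_mat_deriv T (\<lambda>s. F s + E s) (F' + E') t"
proof -
  have c: "F t \<in> carrier_mat p q" "E t \<in> carrier_mat p q"
    using assms by auto
  have "((\<lambda>s. (F s + E s) $$ (i, j)) has_real_derivative (F' + E') $$ (i, j)) (at t within {0..T})"
    if ij: "i < p" "j < q" for i j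
  proof (rule has_real_derivative_within_cong)
    show "((\<lambda>s. F s $$ (i, j) + E s $$ (i, j)) has_real_derivative (F' + E') $$ (i, j))
        (at t within {0..T})"
      using assms(1,2) c ij by (auto simp: has_mat_deriv_def intro!: derivative_intros)
    show "(F s + E s) $$ (i, j) = F s $$ (i, j) + E s $$ (i, j)" if "s \<in> {0..T}" for s
      using assms(4,5)[OF that] ij by auto
  qed (fact assms)
  then show ?thesis
    using assms(1,2) c by (auto simp: has_mat_deriv_def)
qed

lemma has_mat_deriv_diff:
  assumes "has_mat_deriv T F F' t" "has_mat_deriv T E E' t" "t \<in> {0..T}"
    and "\<And>s. s \<in> {0..T} \<Longrightarrow> F s \<in> carrier_mat p q" "\<And>s. s \<in> {0..T} \<Longrightarrow> E s \<in> carrier_mat p q"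
  shows "has_mat_deriv T (\<lambda>s. F s - E s) (F' - E') t"
proof -
  have c: "F t \<in> carrier_mat p q" "E t \<in> carrier_mat p q"
    using assms by auto
  have "((\<lambda>s. (F s - E s) $$ (i, j)) has_real_derivative (F' - E') $$ (i, j)) (at t within {0..T})"
    if ij: "i < p" "j < q" for i j
  proof (rule has_real_derivative_within_cong)
    show "((\<lambda>s. F s $$ (i, j) - E s $$ (i, j)) has_real_derivative (F' - E') $$ (i, j))
        (at t within {0..T})"
      using assms(1,2) c ij by (auto simp: has_mat_deriv_def intro!: derivative_intros)
    show "(F s - E s) $$ (i, j) = F s $$ (i, j) - E s $$ (i, j)" if "s \<in> {0..T}" for s
      using assms(4,5)[OF that] ij by auto
  qed (fact assms)
  then show ?thesis
    using assms(1,2) c by (auto simp: has_mat_deriv_def)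
qed

text \<open>Leibniz rule applied to each term of the finite sum that defines an entry of the
  product; the order of the factors is kept.\<close>

lemma has_mat_deriv_mult:
  assumes "has_mat_deriv T F F' t" "has_mat_deriv T E E' t" "t \<in> {0..T}"
    and F: "\<And>s. s \<in> {0..T} \<Longrightarrow> F s \<in> carrier_mat p q"
    and E: "\<And>s. s \<in> {0..T} \<Longrightarrow> E s \<in> carrier_mat q r"
  shows "has_mat_deriv T (\<lambda>s. F s * E s) (F' * E t + F t * E') t"
proof -
  have c: "F t \<in> carrier_mat p q" "E t \<in> carrier_mat q r"
      "F' \<in> carrier_mat p q" "E' \<in> carrier_mat q r"
    using assms F[of t] E[of t] by (auto simp: has_mat_deriv_def)
  have "((\<lambda>s. (F s * E s) $$ (i, j)) has_real_derivative (F' * E t + F t * E') $$ (i, j))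
      (at t within {0..T})"
    if ij: "i < p" "j < r" for i j
  proof (rule has_real_derivative_within_cong)
    have "(F' * E t + F t * E') $$ (i, j) = (F' * E t) $$ (i, j) + (F t * E') $$ (i, j)"
      using c ij by auto
    also have "\<dots> = (\<Sum>l<q. F' $$ (i, l) * E t $$ (l, j) + F t $$ (i, l) * E' $$ (l, j))"
      by (simp only: sum.distrib index_mult_mat_sum[OF c(1,4) ij] index_mult_mat_sum[OF c(3,2) ij])
    finally have eq: "(F' * E t + F t * E') $$ (i, j) = \<dots>" .
    show "((\<lambda>s. \<Sum>l<q. F s $$ (i, l) * E s $$ (l, j)) has_real_derivative
        (F' * E t + F t * E') $$ (i, j)) (at t within {0..T})"
      unfolding eq using assms(1,2) c ij
      by (intro DERIV_sum DERIV_mult'[THEN DERIV_cong]) (auto simp: has_mat_deriv_def)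
    show "(F s * E s) $$ (i, j) = (\<Sum>l<q. F s $$ (i, l) * E s $$ (l, j))" if "s \<in> {0..T}" for s
      using F[OF that] E[OF that] ij by (rule index_mult_mat_sum)
  qed (fact assms)
  then show ?thesis
    using c by (auto simp: has_mat_deriv_def)
qed

lemma mat_C_k_add:
  "mat_C_k T k p q F \<Longrightarrow> mat_C_k T k p q E \<Longrightarrow> T > 0 \<Longrightarrow> mat_C_k T k p q (\<lambda>t. F t + E t)"
proof (induction k arbitrary: F E)
  case 0
  have "continuous_on {0..T} (\<lambda>t. (F t + E t) $$ (i, j))" if "i < p" "j < q" for i j
  proof (rule continuous_on_eq)
    show "continuous_on {0..T} (\<lambda>t. F t $$ (i, j) + E t $$ (i, j))"
      using 0 that by (auto simp: mat_C_k_0 intro!: continuous_intros)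
    show "F t $$ (i, j) + E t $$ (i, j) = (F t + E t) $$ (i, j)" if "t \<in> {0..T}" for t
      using 0 that \<open>i < p\<close> \<open>j < q\<close> unfolding mat_C_k_0 by (metis carrier_matD index_add_mat(1))
  qed
  with 0 show ?case by (simp add: mat_C_k_0)
next
  case (Suc k)
  show ?case
  proof (rule mat_C_k_SucI)
    show "has_mat_deriv T (\<lambda>t. F t + E t) (mat_deriv T F t + mat_deriv T E t) t"
      if "t \<in> {0..T}" for t
      using Suc.prems that by (intro has_mat_deriv_add[of _ _ _ _ _ _ p q]) (auto simp: mat_C_k_Suc)
    show "mat_C_k T k p q (\<lambda>t. mat_deriv T F t + mat_deriv T E t)"
      using Suc by (auto simp: mat_C_k_Suc)
  qed (use Suc.prems in \<open>auto simp: mat_C_k_Suc\<close>)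
qed

lemma mat_C_k_diff:
  "mat_C_k T k p q F \<Longrightarrow> mat_C_k T k p q E \<Longrightarrow> T > 0 \<Longrightarrow> mat_C_k T k p q (\<lambda>t. F t - E t)"
proof (induction k arbitrary: F E)
  case 0
  have "continuous_on {0..T} (\<lambda>t. (F t - E t) $$ (i, j))" if "i < p" "j < q" for i j
  proof (rule continuous_on_eq)
    show "continuous_on {0..T} (\<lambda>t. F t $$ (i, j) - E t $$ (i, j))"
      using 0 that by (auto simp: mat_C_k_0 intro!: continuous_intros)
    show "F t $$ (i, j) - E t $$ (i, j) = (F t - E t) $$ (i, j)" if "t \<in> {0..T}" for t
      using 0 that \<open>i < p\<close> \<open>j < q\<close> unfolding mat_C_k_0 by (metis carrier_matD index_minus_mat(1))
  qed
  with 0 show ?case by (simp add: mat_C_k_0 minus_carrier_mat)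
next
  case (Suc k)
  show ?case
  proof (rule mat_C_k_SucI)
    show "has_mat_deriv T (\<lambda>t. F t - E t) (mat_deriv T F t - mat_deriv T E t) t"
      if "t \<in> {0..T}" for t
      using Suc.prems that by (intro has_mat_deriv_diff[of _ _ _ _ _ _ p q]) (auto simp: mat_C_k_Suc)
    show "mat_C_k T k p q (\<lambda>t. mat_deriv T F t - mat_deriv T E t)"
      using Suc by (auto simp: mat_C_k_Suc)
  qed (use Suc.prems in \<open>auto simp: mat_C_k_Suc minus_carrier_mat\<close>)
qed

lemma mat_C_k_mult:
  "mat_C_k T k p q F \<Longrightarrow> mat_C_k T k q r E \<Longrightarrow> T > 0 \<Longrightarrow> mat_C_k T k p r (\<lambda>t. F t * E t)"
proof (induction k arbitrary: F E)
  case 0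
  have "continuous_on {0..T} (\<lambda>t. (F t * E t) $$ (i, j))" if "i < p" "j < r" for i j
  proof (rule continuous_on_eq)
    show "continuous_on {0..T} (\<lambda>t. \<Sum>l<q. F t $$ (i, l) * E t $$ (l, j))"
      using 0 that by (auto simp: mat_C_k_0 intro!: continuous_intros)
    show "(\<Sum>l<q. F t $$ (i, l) * E t $$ (l, j)) = (F t * E t) $$ (i, j)" if "t \<in> {0..T}" for t
      using 0 that \<open>i < p\<close> \<open>j < r\<close> index_mult_mat_sum[of "F t" p q "E t" r i j] by (simp add: mat_C_k_0)
  qed
  with 0 show ?case by (auto simp: mat_C_k_0)
next
  case (Suc k)
  show ?case
  proof (rule mat_C_k_SucI)
    show "has_mat_deriv T (\<lambda>t. F t * E t) (mat_deriv T F t * E t + F t * mat_deriv T E t) t"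
      if "t \<in> {0..T}" for t
      using Suc.prems that by (intro has_mat_deriv_mult[of _ _ _ _ _ _ p q r]) (auto simp: mat_C_k_Suc)
    \<comment> \<open>Each summand pairs a differentiated factor, of order \<open>k\<close>, with an
      undifferentiated one, whose order \<open>Suc k\<close> is lowered to \<open>k\<close>.\<close>
    show "mat_C_k T k p r (\<lambda>t. mat_deriv T F t * E t + F t * mat_deriv T E t)"
      using Suc.prems mat_C_k_SucD[OF Suc.prems(1)] mat_C_k_SucD[OF Suc.prems(2)]
      by (intro mat_C_k_add Suc.IH) (simp_all add: mat_C_k_Suc)
    show "F t * E t \<in> carrier_mat p r" if "t \<in> {0..T}" for t
      by (rule mult_carrier_mat[OF Suc.prems(1,2)[THEN mat_C_k_carrier, OF that]])
  qed (fact Suc.prems)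
qed

text \<open>One order is lost to the derivative of \<open>P0\<close>; the other terms are products
  of \<open>P0\<close> with constant matrices.\<close>

lemma mat_C_k_G:
  assumes P: "mat_C_k T (Suc k) n n (P0 B K)" and T: "T > 0"
    and A: "A \<in> carrier_mat n n" and B: "B \<in> carrier_mat n m"
  shows "mat_C_k T k n n (G T A B K)"
proof -
  note c = mat_C_k_const[OF _ T] and P' = mat_C_k_SucD[OF P]
  have "mat_C_k T k n n (\<lambda>t. G T A B K t)"
    unfolding G_def
  proof (intro mat_C_k_add mat_C_k_diff)
    show "mat_C_k T k n n (mat_deriv T (P0 B K))"
      using P by (simp add: mat_C_k_Suc)
    show "mat_C_k T k n n (\<lambda>t. P0 B K t * B * transpose_mat B * P0 B K t)"
      using A B by (intro mat_C_k_mult[OF mat_C_k_mult[OF mat_C_k_mult[OF P' c] c] P'] T) auto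
    show "mat_C_k T k n n (\<lambda>t. transpose_mat A * P0 B K t)"
      using A by (intro mat_C_k_mult[OF _ P'] c T) auto
    show "mat_C_k T k n n (\<lambda>t. P0 B K t * A)"
      using A by (intro mat_C_k_mult[OF P'] c T) auto
  qed (fact T)+
  then show ?thesis by simp
qed

section \<open>Kronecker products and vectorisation\<close>

lemma sum_div_mod:
  fixes f :: "nat \<Rightarrow> nat \<Rightarrow> 'a :: comm_monoid_add"
  shows "(\<Sum>l<a * b. f (l div b) (l mod b)) = (\<Sum>i<a. \<Sum>j<b. f i j)"
proof -
  have "(\<Sum>l = i * b..<i * b + b. f (l div b) (l mod b)) = (\<Sum>j<b. f i j)" for i
  proof -
    have "(\<Sum>l = 0 + i * b..<b + i * b. f (l div b) (l mod b)) = (\<Sum>j<b. f i j)"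
      unfolding sum.shift_bounds_nat_ivl lessThan_atLeast0 by (rule sum.cong) auto
    then show ?thesis by (simp add: add.commute)
  qed
  then show ?thesis
    by (simp flip: sum.nat_group)
qed

lemma block_index_less:
  fixes k r b p :: nat
  assumes "k < b" "r < p"
  shows "k * p + r < b * p"
proof -
  have "k * p + r < Suc k * p" using assms by simp
  also have "\<dots> \<le> b * p" using assms by (intro mult_le_mono1) simp
  finally show ?thesis .
qed

lemma block_index_div_mod:
  fixes a b p :: nat
  assumes "a < b * p"
  shows "a div p < b" "a mod p < p"
  using assms by (auto simp: less_mult_imp_div_less intro!: mod_less_divisor gr0I)

lemma kronecker_carrier:
  "X \<in> carrier_mat a b \<Longrightarrow> Z \<in> carrier_mat c d \<Longrightarrow> X \<otimes>\<^sub>K Z \<in> carrier_mat (a * c) (b * d)"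
  by (auto simp: kronecker_def)

lemma transpose_kronecker:
  "transpose_mat (X \<otimes>\<^sub>K Z) = transpose_mat X \<otimes>\<^sub>K transpose_mat Z"
  by (intro eq_matI) (auto simp: kronecker_def block_index_div_mod)

lemma vec_of_cols_carrier: "X \<in> carrier_mat a b \<Longrightarrow> vec_of_cols X \<in> carrier_vec (a * b)"
  by (auto simp: vec_of_cols_def)

lemma index_vec_of_cols:
  "X \<in> carrier_mat a b \<Longrightarrow> i < a * b \<Longrightarrow> vec_of_cols X $ i = X $$ (i mod a, i div a)"
  by (auto simp: vec_of_cols_def)

lemma mat_of_vec_carrier: "mat_of_vec n v \<in> carrier_mat n n"
  by (simp add: mat_of_vec_def)

lemma vec_of_cols_inject:
  assumes "X \<in> carrier_mat a b" "Y \<in> carrier_mat a b" "vec_of_cols X = vec_of_cols Y"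
  shows "X = Y"
proof (rule eq_matI)
  fix i j assume "i < dim_row Y" "j < dim_col Y"
  with assms(2) have ij: "i < a" "j < b" by auto
  then have l: "j * a + i < a * b"
    using block_index_less[of j b i a] by (simp add: mult.commute)
  show "X $$ (i, j) = Y $$ (i, j)"
    using arg_cong[OF assms(3), of "\<lambda>v. v $ (j * a + i)"] ij
    by (simp add: index_vec_of_cols[OF assms(1) l] index_vec_of_cols[OF assms(2) l])
qed (use assms in auto)

lemma vec_of_cols_mat_of_vec:
  "v \<in> carrier_vec (n * n) \<Longrightarrow> vec_of_cols (mat_of_vec n v) = v"
  by (intro eq_vecI) (auto simp: vec_of_cols_def mat_of_vec_def block_index_div_mod)

lemma vec_of_cols_diff:
  assumes "X \<in> carrier_mat a b" "Y \<in> carrier_mat a b"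
  shows "vec_of_cols (X - Y) = vec_of_cols X - vec_of_cols Y"
  using assms by (intro eq_vecI) (auto simp: vec_of_cols_def block_index_div_mod less_mult_imp_div_less mult.commute)

lemma vec_of_cols_uminus: "vec_of_cols (- X) = - vec_of_cols X"
  by (intro eq_vecI) (auto simp: vec_of_cols_def block_index_div_mod less_mult_imp_div_less mult.commute)

lemma vec_of_cols_zero: "vec_of_cols (0\<^sub>m a b) = 0\<^sub>v (a * b)"
  by (intro eq_vecI) (auto simp: vec_of_cols_def block_index_div_mod less_mult_imp_div_less mult.commute)

text \<open>The classical vec identity. Column stacking puts the row index in the remainder and the
  column index in the quotient, which matches the column indexing of the Kronecker product, so the
  sum over \<open>l\<close> splits into the double sum of the triple product.\<close>

lemma kronecker_mult_vec_of_cols: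
  assumes X: "X \<in> carrier_mat a b" and Z: "Z \<in> carrier_mat c d" and Y: "Y \<in> carrier_mat d b"
  shows "(X \<otimes>\<^sub>K Z) *\<^sub>v vec_of_cols Y = vec_of_cols (Z * Y * transpose_mat X)"
proof (rule eq_vecI)
  have XZ: "X \<otimes>\<^sub>K Z \<in> carrier_mat (a * c) (b * d)"
    using X Z by (rule kronecker_carrier)
  have Yv: "vec_of_cols Y \<in> carrier_vec (b * d)"
    using vec_of_cols_carrier[OF Y] by (simp add: mult.commute)
  have R: "Z * Y * transpose_mat X \<in> carrier_mat c a"
    using X Z Y by simp
  show dims: "dim_vec ((X \<otimes>\<^sub>K Z) *\<^sub>v vec_of_cols Y) = dim_vec (vec_of_cols (Z * Y * transpose_mat X))"
    using XZ vec_of_cols_carrier[OF R] by (simp add: mult.commute)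
  fix i assume "i < dim_vec (vec_of_cols (Z * Y * transpose_mat X))"
  then have i: "i < a * c" using vec_of_cols_carrier[OF R] by (simp add: mult.commute)
  let ?x = "i div c" and ?z = "i mod c"
  have xz: "?x < a" "?z < c" using block_index_div_mod[OF i] .
  have "((X \<otimes>\<^sub>K Z) *\<^sub>v vec_of_cols Y) $ i
      = (\<Sum>l<b * d. (X \<otimes>\<^sub>K Z) $$ (i, l) * vec_of_cols Y $ l)"
    using XZ Yv i by (rule index_mult_mat_vec_sum)
  also have "\<dots> = (\<Sum>l<b * d. X $$ (?x, l div d) * Z $$ (?z, l mod d) * Y $$ (l mod d, l div d))"
    using X Z Y i by (intro sum.cong) (auto simp: kronecker_def vec_of_cols_def mult.commute)
  also have "\<dots> = (\<Sum>j<b. \<Sum>k<d. X $$ (?x, j) * Z $$ (?z, k) * Y $$ (k, j))"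
    by (rule sum_div_mod)
  also have "\<dots> = (\<Sum>j<b. (Z * Y) $$ (?z, j) * transpose_mat X $$ (j, ?x))"
    using X xz by (intro sum.cong refl)
      (auto simp: index_mult_mat_sum[OF Z Y] sum_distrib_right sum_distrib_left mult_ac)
  also have "\<dots> = (Z * Y * transpose_mat X) $$ (?z, ?x)"
    using X Z Y xz by (intro index_mult_mat_sum[symmetric, of _ c b _ a]) auto
  also have "\<dots> = vec_of_cols (Z * Y * transpose_mat X) $ i"
    using index_vec_of_cols[OF R] i by (simp add: mult.commute)
  finally show "((X \<otimes>\<^sub>K Z) *\<^sub>v vec_of_cols Y) $ i = vec_of_cols (Z * Y * transpose_mat X) $ i" .
qed

section \<open>The coefficient matrices of the vectorised problem\<close>

lemma A_tilde_carrier: "A \<in> carrier_mat n n \<Longrightarrow> A_tilde A \<in> carrier_mat (n * n) (n * n)"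
  by (auto simp: A_tilde_def kronecker_def)

lemma B_tilde_carrier: "B \<in> carrier_mat n m \<Longrightarrow> B_tilde B \<in> carrier_mat (n * n) (n * m)"
  by (auto simp: B_tilde_def kronecker_def)

text \<open>Transposition distributes over the Kronecker product, so the vec identity, with the
  identity matrix as left or as right factor, yields the two terms.\<close>

lemma transpose_A_tilde_mult_vec:
  assumes A: "A \<in> carrier_mat n n" and Y: "Y \<in> carrier_mat n n"
  shows "transpose_mat (A_tilde A) *\<^sub>v vec_of_cols Y
    = vec_of_cols (- (transpose_mat A * Y) - Y * A)"
proof -
  have At: "transpose_mat A \<in> carrier_mat n n" using A by simp
  note c = kronecker_carrier[OF one_carrier_mat At] kronecker_carrier[OF At one_carrier_mat]
  have "transpose_mat (A_tilde A)
      = - (transpose_mat (1\<^sub>m n \<otimes>\<^sub>K A)) - transpose_mat (A \<otimes>\<^sub>K 1\<^sub>m n)"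
    using A by (intro eq_matI) (auto simp: A_tilde_def kronecker_def)
  also have "\<dots> = - (1\<^sub>m n \<otimes>\<^sub>K transpose_mat A) - transpose_mat A \<otimes>\<^sub>K 1\<^sub>m n"
    by (simp add: transpose_kronecker)
  finally have "transpose_mat (A_tilde A) *\<^sub>v vec_of_cols Y
      = - ((1\<^sub>m n \<otimes>\<^sub>K transpose_mat A) *\<^sub>v vec_of_cols Y)
        - (transpose_mat A \<otimes>\<^sub>K 1\<^sub>m n) *\<^sub>v vec_of_cols Y"
    using c[of n] vec_of_cols_carrier[OF Y] carrier_matD(2)[OF c(1)[of n]]
      carrier_vecD[OF vec_of_cols_carrier[OF Y]]
    by (simp add: minus_mult_distrib_mat_vec[of _ "n * n" "n * n"])
  also have "\<dots> = - vec_of_cols (transpose_mat A * Y) - vec_of_cols (Y * A)"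
    using A Y by (simp add: kronecker_mult_vec_of_cols[OF one_carrier_mat At Y]
        kronecker_mult_vec_of_cols[OF At one_carrier_mat Y])
  finally show ?thesis
    using A Y by (simp add: vec_of_cols_diff[of _ n n] vec_of_cols_uminus)
qed

lemma transpose_B_tilde_mult_vec:
  assumes B: "B \<in> carrier_mat n m" and Y: "Y \<in> carrier_mat n n"
  shows "transpose_mat (B_tilde B) *\<^sub>v vec_of_cols Y = vec_of_cols (transpose_mat B * Y)"
proof -
  have Bt: "transpose_mat B \<in> carrier_mat m n" using B by simp
  show ?thesis
    using B Y by (simp add: B_tilde_def transpose_kronecker
        kronecker_mult_vec_of_cols[OF one_carrier_mat Bt Y] right_mult_one_mat[of _ m n])
qed

lemma stack_mat_mult_vec:
  assumes "\<And>k. k < b \<Longrightarrow> F k \<in> carrier_mat p q" "v \<in> carrier_vec q"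
  shows "stack_mat b p q F *\<^sub>v v = stack_vec b p (\<lambda>k. F k *\<^sub>v v)"
proof (rule eq_vecI)
  fix a assume "a < dim_vec (stack_vec b p (\<lambda>k. F k *\<^sub>v v))"
  then have a: "a < b * p" by (simp add: stack_vec_def)
  note a' = block_index_div_mod[OF a]
  have "stack_mat b p q F \<in> carrier_mat (b * p) q" by (simp add: stack_mat_def)
  from index_mult_mat_vec_sum[OF this assms(2) a]
    index_mult_mat_vec_sum[OF assms(1)[OF a'(1)] assms(2) a'(2)] a
  show "(stack_mat b p q F *\<^sub>v v) $ a = stack_vec b p (\<lambda>k. F k *\<^sub>v v) $ a"
    by (simp add: stack_mat_def stack_vec_def)
qed (simp add: stack_mat_def stack_vec_def)

section \<open>Invertibility of H under controllability\<close>

lemma mat_inv: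
  assumes X: "X \<in> carrier_mat n n" and "det X \<noteq> 0"
  shows "X * mat_inv X = 1\<^sub>m n" "mat_inv X * X = 1\<^sub>m n" "mat_inv X \<in> carrier_mat n n"
proof -
  have "mat_inverse X \<noteq> None"
    \<comment> \<open>\<open>b\<close> is a dummy parameter of the matrix ring; both facts must use
      the same value.\<close>
    using mat_inverse(1)[OF X, where b = "()"] det_non_zero_imp_unit[OF assms, where b = "()"] by blast
  then obtain Z where "mat_inverse X = Some Z"
    by blast
  with mat_inverse(2)[OF X this]
  show "X * mat_inv X = 1\<^sub>m n" "mat_inv X * X = 1\<^sub>m n" "mat_inv X \<in> carrier_mat n n"
    by (simp_all add: mat_inv_def)
qed

text \<open>A single input makes the Kalman matrix square, so full rank means a nonzero
  determinant.\<close>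

lemma controllable_imp_det_nonzero:
  assumes "A \<in> carrier_mat n n" "B \<in> carrier_mat n 1" "controllable A B"
  shows "controllability_matrix A B \<in> carrier_mat n n" "det (controllability_matrix A B) \<noteq> 0"
proof -
  show c: "controllability_matrix A B \<in> carrier_mat n n"
    using assms by (auto simp: controllability_matrix_def)
  interpret vec_space "TYPE(real)" n .
  show "det (controllability_matrix A B) \<noteq> 0"
    using assms c by (simp add: det_rank_iff controllable_def mat_rank_def)
qed

lemma obs_block_carrier:
  "A \<in> carrier_mat n n \<Longrightarrow> B \<in> carrier_mat n m \<Longrightarrow> obs_block A B k \<in> carrier_mat (n * m) (n * n)"
  unfolding obs_block_def
  by (intro mult_carrier_mat[of _ _ "n * n"] pow_carrier_mat)
    (auto dest: A_tilde_carrier B_tilde_carrier)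

text \<open>Transposition reverses products while \<open>^\<^sub>m\<close> appends its new factor on
  the right; the gap is closed by commuting \<open>transpose_mat X\<close> past its own
  powers.\<close>

lemma transpose_pow_mat:
  fixes X :: "'a :: comm_semiring_1 mat"
  assumes X: "X \<in> carrier_mat n n"
  shows "transpose_mat (X ^\<^sub>m k) = transpose_mat X ^\<^sub>m k"
proof -
  have comm: "transpose_mat X * transpose_mat X ^\<^sub>m k = transpose_mat X ^\<^sub>m k * transpose_mat X" for k
  proof (induction k)
    case (Suc k)
    have c: "transpose_mat X \<in> carrier_mat n n" "transpose_mat X ^\<^sub>m k \<in> carrier_mat n n"
      using X by auto
    show ?case
      using c(1) by (simp add: assoc_mult_mat[OF c(1) c(2) c(1), symmetric] Suc)
  qed (use X in simp)
  show ?thesis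
  proof (induction k)
    case (Suc k)
    then show ?case
      using transpose_mult[OF pow_carrier_mat[OF X] X, of k] by (simp add: comm)
  qed (use X in simp)
qed

text \<open>Under column stacking the transpose of \<open>A_tilde A\<close> acts as
  \<open>L\<close>, hence its powers act as iterates of \<open>L\<close>. This moves the study of
  the blocks of \<open>H\<close> from vectors back to matrices.\<close>

lemma obs_block_mult_vec_of_cols:
  assumes A: "A \<in> carrier_mat n n" and B: "B \<in> carrier_mat n m" and Y: "Y \<in> carrier_mat n n"
  defines "L \<equiv> \<lambda>Y. - (transpose_mat A * Y) - Y * A"
  shows "(L ^^ k) Y \<in> carrier_mat n n"
    and "obs_block A B k *\<^sub>v vec_of_cols Y = vec_of_cols (transpose_mat B * (L ^^ k) Y)"
proof -
  have L: "L Y \<in> carrier_mat n n" if "Y \<in> carrier_mat n n" for Y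
    unfolding L_def using A that by (intro minus_carrier_mat mult_carrier_mat[of _ n n])
  have Lk: "(L ^^ k) Y \<in> carrier_mat n n" if "Y \<in> carrier_mat n n" for Y k
    by (induction k) (simp_all add: L that)
  then show "(L ^^ k) Y \<in> carrier_mat n n"
    using Y .
  have M: "transpose_mat (A_tilde A) \<in> carrier_mat (n * n) (n * n)"
    using A_tilde_carrier[OF A] by simp
  have pow: "transpose_mat (A_tilde A) ^\<^sub>m k *\<^sub>v vec_of_cols Y = vec_of_cols ((L ^^ k) Y)"
    using Y
  proof (induction k arbitrary: Y)
    case 0
    then show ?case
      using vec_of_cols_carrier[of Y n n] A_tilde_carrier[OF A] by simp
  next
    case (Suc k)
    \<comment> \<open>The last factor of the power meets the vector first, so \<open>L\<close> is
      applied innermost and the induction hypothesis is used at \<open>L Y\<close>.\<close>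
    have "transpose_mat (A_tilde A) ^\<^sub>m Suc k *\<^sub>v vec_of_cols Y
        = transpose_mat (A_tilde A) ^\<^sub>m k *\<^sub>v (transpose_mat (A_tilde A) *\<^sub>v vec_of_cols Y)"
      using assoc_mult_mat_vec[OF pow_carrier_mat[OF M] M vec_of_cols_carrier[OF Suc.prems]] by simp
    also have "\<dots> = transpose_mat (A_tilde A) ^\<^sub>m k *\<^sub>v vec_of_cols (L Y)"
      by (simp add: transpose_A_tilde_mult_vec[OF A Suc.prems] L_def)
    also have "\<dots> = vec_of_cols ((L ^^ Suc k) Y)"
      using Suc.IH[OF L[OF Suc.prems]] by (simp add: funpow_swap1)
    finally show ?case .
  qed
  show "obs_block A B k *\<^sub>v vec_of_cols Y = vec_of_cols (transpose_mat B * (L ^^ k) Y)"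
    unfolding obs_block_def
    using assoc_mult_mat_vec[of "transpose_mat (B_tilde B)" "n * m" "n * n"
        "transpose_mat (A_tilde A) ^\<^sub>m k" "n * n" "vec_of_cols Y"]
      B_tilde_carrier[OF B] pow_carrier_mat[OF M] vec_of_cols_carrier[OF Y]
    by (simp add: pow transpose_B_tilde_mult_vec[OF B Lk[OF Y]])
qed

text \<open>With a single input, column \<open>k\<close> of the Kalman matrix is
  \<open>A ^\<^sub>m k * B\<close>, so each hypothesis annihilates one row of the product.\<close>

lemma transpose_controllability_mult_eq_0:
  assumes A: "A \<in> carrier_mat n n" and B: "B \<in> carrier_mat n 1" and Y: "Y \<in> carrier_mat n n"
    and 0: "\<And>k. k < n \<Longrightarrow> transpose_mat B * transpose_mat A ^\<^sub>m k * Y = 0\<^sub>m 1 n"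
  shows "transpose_mat (controllability_matrix A B) * Y = 0\<^sub>m n n"
proof (rule eq_matI)
  let ?C = "controllability_matrix A B"
  have C: "?C \<in> carrier_mat n n"
    using A B by (auto simp: controllability_matrix_def)
  fix k j assume "k < dim_row (0\<^sub>m n n :: real mat)" "j < dim_col (0\<^sub>m n n :: real mat)"
  then have kj: "k < n" "j < n" by auto
  have eq: "transpose_mat (A ^\<^sub>m k * B) = transpose_mat B * transpose_mat A ^\<^sub>m k"
    using transpose_mult[OF pow_carrier_mat[OF A] B] by (simp add: transpose_pow_mat[OF A])
  have AB: "transpose_mat (A ^\<^sub>m k * B) \<in> carrier_mat 1 n"
    using A B by auto
  have "(transpose_mat ?C * Y) $$ (k, j) = (\<Sum>l<n. transpose_mat ?C $$ (k, l) * Y $$ (l, j))"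
    using C Y kj by (intro index_mult_mat_sum) auto
  also have "\<dots> = (\<Sum>l<n. transpose_mat (A ^\<^sub>m k * B) $$ (0, l) * Y $$ (l, j))"
    using A B kj by (intro sum.cong) (auto simp: controllability_matrix_def)
  also have "\<dots> = (transpose_mat (A ^\<^sub>m k * B) * Y) $$ (0, j)"
    using AB Y kj by (intro index_mult_mat_sum[symmetric]) auto
  also have "\<dots> = 0"
    using 0[OF kj(1)] kj by (simp add: eq)
  finally show "(transpose_mat ?C * Y) $$ (k, j) = 0\<^sub>m n n $$ (k, j)"
    using kj by simp
qed (use A B Y in \<open>auto simp: controllability_matrix_def\<close>)

section \<open>\<open>H\<close> and \<open>N\<close> acting on vectors block by block\<close>

lemma H_mat_carrier:
  "A \<in> carrier_mat n n \<Longrightarrow> B \<in> carrier_mat n 1 \<Longrightarrow> H_mat A B \<in> carrier_mat (n * n) (n * n)"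
  by (auto simp: H_mat_def stack_mat_def Let_def)

lemma N_mat_carrier:
  "A \<in> carrier_mat n n \<Longrightarrow> B \<in> carrier_mat n 1 \<Longrightarrow> N_mat A B \<in> carrier_mat (n * n) (n * n)"
  by (auto simp: N_mat_def stack_mat_def Let_def)

lemma H_mat_mult_vec:
  assumes A: "A \<in> carrier_mat n n" and B: "B \<in> carrier_mat n 1" and v: "v \<in> carrier_vec (n * n)"
  shows "H_mat A B *\<^sub>v v = stack_vec n n (\<lambda>k. obs_block A B k *\<^sub>v v)"
proof -
  have "H_mat A B = stack_mat n n (n * n) (obs_block A B)"
    using A B by (simp add: H_mat_def Let_def)
  then show ?thesis
    using obs_block_carrier[OF A B] v by (simp add: stack_mat_mult_vec)
qed

lemma N_mat_mult_vec:
  assumes A: "A \<in> carrier_mat n n" and B: "B \<in> carrier_mat n 1" and v: "v \<in> carrier_vec (n * n)"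
  shows "N_mat A B *\<^sub>v v
    = stack_vec n n (\<lambda>k. if k = 0 then 0\<^sub>v n else - (obs_block A B (k - 1) *\<^sub>v v))"
proof -
  let ?F = "\<lambda>k. if k = 0 then 0\<^sub>m n (n * n) else - obs_block A B (k - 1)"
  have o: "obs_block A B k \<in> carrier_mat n (n * n)" for k
    using obs_block_carrier[OF A B, of k] by simp
  have "N_mat A B = stack_mat n n (n * n) ?F"
    using A B by (simp add: N_mat_def Let_def)
  moreover have "stack_mat n n (n * n) ?F *\<^sub>v v = stack_vec n n (\<lambda>k. ?F k *\<^sub>v v)"
    using o v by (intro stack_mat_mult_vec) auto
  moreover have "(\<lambda>k. ?F k *\<^sub>v v) = (\<lambda>k. if k = 0 then 0\<^sub>v n else - (obs_block A B (k - 1) *\<^sub>v v))"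
    using v carrier_matD(2)[OF o] by (auto simp: fun_eq_iff)
  ultimately show ?thesis by simp
qed

lemma det_H_mat:
  assumes A: "A \<in> carrier_mat n n" and B: "B \<in> carrier_mat n 1" and AB: "controllable A B"
  shows "det (H_mat A B) \<noteq> 0"
proof
  assume "det (H_mat A B) = 0"
  then obtain v where v: "v \<in> carrier_vec (n * n)" "v \<noteq> 0\<^sub>v (n * n)"
    and Hv: "H_mat A B *\<^sub>v v = 0\<^sub>v (n * n)"
    using det_0_iff_vec_prod_zero_field[OF H_mat_carrier[OF A B]] by blast
  \<comment> \<open>A nonzero kernel vector of \<open>H\<close>, read as a matrix; the aim is
    \<open>Y = 0\<close>.\<close>
  define Y where "Y = mat_of_vec n v"
  define L where "L = (\<lambda>Y. - (transpose_mat A * Y) - Y * A)"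
  have Y: "Y \<in> carrier_mat n n" and vY: "v = vec_of_cols Y"
    using v by (auto simp: Y_def mat_of_vec_carrier vec_of_cols_mat_of_vec)
  have Lk: "(L ^^ k) Y \<in> carrier_mat n n" for k
    unfolding L_def by (rule obs_block_mult_vec_of_cols[OF A B Y])
  have At: "transpose_mat A \<in> carrier_mat n n" and Bt: "transpose_mat B \<in> carrier_mat 1 n"
    using A B by auto
  have base: "transpose_mat B * (L ^^ k) Y = 0\<^sub>m 1 n" if k: "k < n" for k
  proof (rule vec_of_cols_inject)
    have "vec_of_cols (transpose_mat B * (L ^^ k) Y) = obs_block A B k *\<^sub>v v"
      unfolding L_def vY by (rule obs_block_mult_vec_of_cols(2)[OF A B Y, symmetric])
    also have "\<dots> = 0\<^sub>v n"
    proof (rule eq_vecI)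
      fix r assume "r < dim_vec (0\<^sub>v n :: real vec)"
      then have r: "r < n" by simp
      have "(H_mat A B *\<^sub>v v) $ (k * n + r) = (obs_block A B k *\<^sub>v v) $ r"
        using block_index_less[OF k r] r by (simp add: H_mat_mult_vec[OF A B v(1)] stack_vec_def)
      then show "(obs_block A B k *\<^sub>v v) $ r = 0\<^sub>v n $ r"
        using block_index_less[OF k r] r by (simp add: Hv)
    qed (use obs_block_carrier[OF A B, of k] in simp)
    finally show "vec_of_cols (transpose_mat B * (L ^^ k) Y) = vec_of_cols (0\<^sub>m 1 n)"
      by (simp add: vec_of_cols_zero)
  qed (rule mult_carrier_mat[OF Bt Lk] zero_carrier_mat)+
  \<comment> \<open>Powers of the transposed \<open>A\<close> are traded for iterates of
    \<open>L\<close>. Each step in \<open>j\<close> uses the hypothesis at \<open>i\<close> and at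
    \<open>Suc i\<close>, so \<open>i\<close> must vary, and the bound on \<open>i + j\<close> keeps
    the iterates within the range of \<open>base\<close>. The conclusion is drawn at
    \<open>i = 0\<close>.\<close>
  have step: "transpose_mat B * transpose_mat A ^\<^sub>m j * (L ^^ i) Y = 0\<^sub>m 1 n" if "i + j < n" for i j
    using that
  proof (induction j arbitrary: i)
    case 0
    then show ?case using base[of i] Bt At by simp
  next
    case (Suc j)
    let ?R = "transpose_mat B * transpose_mat A ^\<^sub>m j" and ?W = "(L ^^ i) Y"
    note W = Lk[of i] and LW = Lk[of "Suc i"]
    have R: "?R \<in> carrier_mat 1 n"
      by (rule mult_carrier_mat[OF Bt pow_carrier_mat[OF At]])
    \<comment> \<open>The definition of \<open>L\<close>, solved for
      \<open>transpose_mat A * ?W\<close>.\<close>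
    have "transpose_mat A * ?W = - (L ^^ Suc i) Y - ?W * A"
      using At A W by (intro eq_matI) (auto simp: L_def)
    then have "?R * (transpose_mat A * ?W) = - (?R * (L ^^ Suc i) Y) - ?R * (?W * A)"
      using R LW W A by (simp add: mult_minus_distrib_mat[of _ 1 n _ n])
    also have "?R * (L ^^ Suc i) Y = 0\<^sub>m 1 n"
      using Suc.prems by (intro Suc.IH) simp
    also have "?R * (?W * A) = ?R * ?W * A"
      using R W A by (intro assoc_mult_mat[symmetric])
    also have "?R * ?W = 0\<^sub>m 1 n"
      using Suc.prems by (intro Suc.IH) simp
    finally have "?R * (transpose_mat A * ?W) = 0\<^sub>m 1 n"
      using A by (auto intro!: eq_matI)
    moreover have "transpose_mat B * transpose_mat A ^\<^sub>m Suc j * ?W = ?R * (transpose_mat A * ?W)"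
      using assoc_mult_mat[OF Bt pow_carrier_mat[OF At] At] assoc_mult_mat[OF R At W] by simp
    ultimately show ?case by simp
  qed
  let ?C = "transpose_mat (controllability_matrix A B)"
  note C = controllable_imp_det_nonzero[OF A B AB]
  have Ct: "?C \<in> carrier_mat n n" "det ?C \<noteq> 0"
    using C by (auto simp: det_transpose[OF C(1)])
  have "Y = mat_inv ?C * ?C * Y"
    using mat_inv[OF Ct] Y by simp
  also have "\<dots> = mat_inv ?C * (?C * Y)"
    using mat_inv(3)[OF Ct] Ct(1) Y by (rule assoc_mult_mat)
  also have "?C * Y = 0\<^sub>m n n"
    using step[of 0] by (intro transpose_controllability_mult_eq_0[OF A B Y]) simp
  also have "mat_inv ?C * 0\<^sub>m n n = 0\<^sub>m n n"
    using mat_inv(3)[OF Ct] by simp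
  finally show False
    using v(2) by (simp add: vY vec_of_cols_zero)
qed

section \<open>Derivatives of the output\<close>

text \<open>\<open>vec_deriv\<close> has a value even where no derivative exists; this relation
  records differentiability as well, in analogy with \<open>has_mat_deriv\<close>.\<close>

definition has_vec_deriv :: "real \<Rightarrow> (real \<Rightarrow> real vec) \<Rightarrow> real vec \<Rightarrow> real \<Rightarrow> bool" where
  "has_vec_deriv T u d t \<longleftrightarrow> dim_vec d = dim_vec (u t) \<and>
     (\<forall>i < dim_vec d. ((\<lambda>s. u s $ i) has_real_derivative d $ i) (at t within {0..T}))"

lemma has_vec_deriv_imp_vec_deriv:
  assumes "has_vec_deriv T u d t" "t \<in> {0..T}" "T > 0"
  shows "vec_deriv T u t = d"
  using assms unfolding has_vec_deriv_def vec_deriv_def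
  by (auto intro!: eq_vecI vector_derivative_within_closed_interval
      simp: has_real_derivative_iff_has_vector_derivative)

lemma has_vec_deriv_cong:
  assumes "has_vec_deriv T u' d t" "t \<in> {0..T}" "\<And>s. s \<in> {0..T} \<Longrightarrow> u s = u' s"
  shows "has_vec_deriv T u d t"
proof -
  have "((\<lambda>s. u s $ i) has_real_derivative d $ i) (at t within {0..T})"
    if "((\<lambda>s. u' s $ i) has_real_derivative d $ i) (at t within {0..T})" for i
    using that assms(2) by (rule has_real_derivative_within_cong) (simp only: assms(3))
  with assms(1) show ?thesis
    unfolding has_vec_deriv_def assms(3)[OF assms(2)] by blast
qed

lemma has_real_derivative_mult_mat_vec:
  assumes X: "X \<in> carrier_mat p q" and u: "\<And>s. s \<in> {0..T} \<Longrightarrow> u s \<in> carrier_vec q"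
    and d: "has_vec_deriv T u d t" and t: "t \<in> {0..T}" and i: "i < p"
  shows "((\<lambda>s. (X *\<^sub>v u s) $ i) has_real_derivative (X *\<^sub>v d) $ i) (at t within {0..T})"
proof (rule has_real_derivative_within_cong)
  have dc: "d \<in> carrier_vec q"
    using d carrier_vecD[OF u[OF t]] by (intro carrier_vecI) (simp add: has_vec_deriv_def)
  show "((\<lambda>s. \<Sum>l<q. X $$ (i, l) * u s $ l) has_real_derivative (X *\<^sub>v d) $ i) (at t within {0..T})"
    unfolding index_mult_mat_vec_sum[OF X dc i] using d dc
    by (intro DERIV_sum DERIV_cmult) (auto simp: has_vec_deriv_def)
  show "(X *\<^sub>v u s) $ i = (\<Sum>l<q. X $$ (i, l) * u s $ l)" if "s \<in> {0..T}" for s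
    using X u[OF that] i by (rule index_mult_mat_vec_sum)
qed (fact t)

text \<open>Column stacking merely relabels entries; the two directions use mutually inverse index
  maps.\<close>

lemma has_mat_deriv_iff_vec_of_cols:
  assumes F: "\<And>s. s \<in> {0..T} \<Longrightarrow> F s \<in> carrier_mat a b" and D: "D \<in> carrier_mat a b"
    and t: "t \<in> {0..T}"
  shows "has_mat_deriv T F D t \<longleftrightarrow> has_vec_deriv T (\<lambda>s. vec_of_cols (F s)) (vec_of_cols D) t"
proof
  assume *: "has_mat_deriv T F D t"
  have "((\<lambda>s. vec_of_cols (F s) $ l) has_real_derivative vec_of_cols D $ l) (at t within {0..T})"
    if l: "l < a * b" for l
  proof (rule has_real_derivative_within_cong)
    have "l mod a < a" "l div a < b"
      using l block_index_div_mod[of l b a] by (auto simp: mult.commute)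
    then show "((\<lambda>s. F s $$ (l mod a, l div a)) has_real_derivative vec_of_cols D $ l)
        (at t within {0..T})"
      using * D l by (simp add: has_mat_deriv_def index_vec_of_cols[OF D])
  next
    fix s assume "s \<in> {0..T}"
    then show "vec_of_cols (F s) $ l = F s $$ (l mod a, l div a)"
      using F l by (intro index_vec_of_cols)
  qed (fact t)
  then show "has_vec_deriv T (\<lambda>s. vec_of_cols (F s)) (vec_of_cols D) t"
    using vec_of_cols_carrier[OF F[OF t]] vec_of_cols_carrier[OF D]
    by (simp add: has_vec_deriv_def)
next
  assume *: "has_vec_deriv T (\<lambda>s. vec_of_cols (F s)) (vec_of_cols D) t"
  have "((\<lambda>s. F s $$ (i, j)) has_real_derivative D $$ (i, j)) (at t within {0..T})"
    if ij: "i < a" "j < b" for i j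
  proof (rule has_real_derivative_within_cong)
    have l: "j * a + i < a * b"
      using block_index_less[of j b i a] ij by (simp add: mult.commute)
    show "((\<lambda>s. vec_of_cols (F s) $ (j * a + i)) has_real_derivative D $$ (i, j))
        (at t within {0..T})"
      using * l ij vec_of_cols_carrier[OF D]
      by (auto simp: has_vec_deriv_def index_vec_of_cols[OF D l])
    show "F s $$ (i, j) = vec_of_cols (F s) $ (j * a + i)" if "s \<in> {0..T}" for s
      using ij by (simp add: index_vec_of_cols[OF F[OF that] l])
  qed (fact t)
  then show "has_mat_deriv T F D t"
    using F[OF t] D by (simp add: has_mat_deriv_def)
qed

lemma mat_deriv_funpow_carrier:
  "F t \<in> carrier_mat p q \<Longrightarrow> (mat_deriv T ^^ i) F t \<in> carrier_mat p q"
  by (induction i) (auto simp: mat_deriv_def)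

lemma mat_C_k_has_vec_deriv:
  assumes "mat_C_k T k p q F" "i < k" "t \<in> {0..T}"
  shows "has_vec_deriv T (\<lambda>s. vec_of_cols ((mat_deriv T ^^ i) F s))
    (vec_of_cols ((mat_deriv T ^^ Suc i) F t)) t"
proof -
  have "has_mat_deriv T ((mat_deriv T ^^ i) F) ((mat_deriv T ^^ Suc i) F t) t"
    using assms by (simp add: mat_C_k_def)
  moreover have "(mat_deriv T ^^ j) F s \<in> carrier_mat p q" if "s \<in> {0..T}" for j s
    using mat_C_k_carrier[OF assms(1) that] by (rule mat_deriv_funpow_carrier)
  ultimately show ?thesis
    using has_mat_deriv_iff_vec_of_cols[of T "(mat_deriv T ^^ i) F" p q] assms(3) by blast
qed

lemma has_real_derivative_within_unique:
  fixes f :: "real \<Rightarrow> real"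
  assumes "(f has_real_derivative d) (at t within {0..T})"
    and "(f has_real_derivative e) (at t within {0..T})" "t \<in> {0..T}" "T > 0"
  shows "d = e"
  using assms vector_derivative_within_closed_interval[of 0 T t f]
  by (auto simp: has_real_derivative_iff_has_vector_derivative)

text \<open>Induction on \<open>k\<close>: the formula holds on the whole interval, so it may be
  differentiated in time, and the derivative of the left side is expanded by the differential
  equation. \<open>g i\<close> plays the \<open>i\<close>-th derivative of the forcing term. The
  case \<open>k = 0\<close> is separated because \<open>k - 1\<close> truncates to 0 and would leave
  a spurious \<open>q\<close> term.\<close>

lemma output_derivatives:
  fixes C M :: "real mat" and g :: "nat \<Rightarrow> real \<Rightarrow> real vec"
  assumes C: "C \<in> carrier_mat p d" and M: "M \<in> carrier_mat d d" and q: "q \<in> carrier_vec d"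
    and T: "T > 0"
    and g: "\<And>i t. t \<in> {0..T} \<Longrightarrow> g i t \<in> carrier_vec d"
    and g': "\<And>i t. i < l \<Longrightarrow> t \<in> {0..T} \<Longrightarrow> has_vec_deriv T (g i) (g (Suc i) t) t"
    and y: "\<And>t. t \<in> {0..T} \<Longrightarrow> y t \<in> carrier_vec d"
    and y': "\<And>t. t \<in> {0..T} \<Longrightarrow> has_vec_deriv T y (M *\<^sub>v y t - q - g 0 t) t"
    and Cy: "\<And>t. t \<in> {0..T} \<Longrightarrow> C *\<^sub>v y t = 0\<^sub>v p"
    and "k \<le> l" "t \<in> {0..T}" and r: "r < p"
  shows "(C * M ^\<^sub>m k *\<^sub>v y t) $ r
    = (if k = 0 then 0 else (C * M ^\<^sub>m (k - 1) *\<^sub>v q) $ r)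
      + (\<Sum>i<k. (C * M ^\<^sub>m (k - 1 - i) *\<^sub>v g i t) $ r)"
  using \<open>k \<le> l\<close> \<open>t \<in> {0..T}\<close>
proof (induction k arbitrary: t)
  case 0
  then show ?case using C M Cy r by simp
next
  case (Suc k)
  have CM: "C * M ^\<^sub>m j \<in> carrier_mat p d" for j
    by (rule mult_carrier_mat[OF C pow_carrier_mat[OF M]])
  \<comment> \<open>The \<open>q\<close> term of the induction hypothesis; it is constant in time,
    whence the \<open>0 +\<close> in the derivative below.\<close>
  let ?c = "if k = 0 then 0 else (C * M ^\<^sub>m (k - 1) *\<^sub>v q) $ r"
  have My: "M *\<^sub>v y t \<in> carrier_vec d"
    using M y[OF Suc.prems(2)] by (rule mult_mat_vec_carrier)
  have "((\<lambda>s. ?c + (\<Sum>i<k. (C * M ^\<^sub>m (k - 1 - i) *\<^sub>v g i s) $ r)) has_real_derivative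
      0 + (\<Sum>i<k. (C * M ^\<^sub>m (k - 1 - i) *\<^sub>v g (Suc i) t) $ r)) (at t within {0..T})"
    using Suc.prems CM g g' r
    by (intro DERIV_add DERIV_const DERIV_sum has_real_derivative_mult_mat_vec) auto
  then have "((\<lambda>s. (C * M ^\<^sub>m k *\<^sub>v y s) $ r) has_real_derivative
      0 + (\<Sum>i<k. (C * M ^\<^sub>m (k - 1 - i) *\<^sub>v g (Suc i) t) $ r)) (at t within {0..T})"
    using Suc.prems by (elim has_real_derivative_within_cong) (simp_all add: Suc.IH)
  moreover have "((\<lambda>s. (C * M ^\<^sub>m k *\<^sub>v y s) $ r) has_real_derivative
      (C * M ^\<^sub>m k *\<^sub>v (M *\<^sub>v y t - q - g 0 t)) $ r) (at t within {0..T})"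
    using Suc.prems CM y y' r by (intro has_real_derivative_mult_mat_vec) auto
  \<comment> \<open>Both derivatives belong to the same function on a nondegenerate interval, so
    they coincide.\<close>
  ultimately have "(C * M ^\<^sub>m k *\<^sub>v (M *\<^sub>v y t - q - g 0 t)) $ r
      = (\<Sum>i<k. (C * M ^\<^sub>m (k - 1 - i) *\<^sub>v g (Suc i) t) $ r)"
    using has_real_derivative_within_unique Suc.prems(2) T by force
  moreover have "C * M ^\<^sub>m k *\<^sub>v (M *\<^sub>v y t - q - g 0 t)
      = C * M ^\<^sub>m k *\<^sub>v (M *\<^sub>v y t) - C * M ^\<^sub>m k *\<^sub>v q - C * M ^\<^sub>m k *\<^sub>v g 0 t"
    using mult_minus_distrib_mat_vec[OF CM minus_carrier_vec[OF My q] g[OF Suc.prems(2)]]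
      mult_minus_distrib_mat_vec[OF CM My q] by simp
  moreover have "C * M ^\<^sub>m k *\<^sub>v (M *\<^sub>v y t) = C * M ^\<^sub>m Suc k *\<^sub>v y t"
    using assoc_mult_mat_vec[OF CM M y[OF Suc.prems(2)], of k] assoc_mult_mat[OF C pow_carrier_mat[OF M] M]
    by simp
  ultimately have "(C * M ^\<^sub>m Suc k *\<^sub>v y t) $ r = (C * M ^\<^sub>m k *\<^sub>v q) $ r
      + ((C * M ^\<^sub>m k *\<^sub>v g 0 t) $ r + (\<Sum>i<k. (C * M ^\<^sub>m (k - 1 - i) *\<^sub>v g (Suc i) t) $ r))"
    using C r by simp
  \<comment> \<open>The new \<open>g 0\<close> term is the summand \<open>i = 0\<close>; the
    differentiated sum supplies the others after a shift of the index.\<close>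
  then show ?case
    by (simp add: sum.lessThan_Suc_shift del: sum.lessThan_Suc)
qed

section \<open>Regularity of the inhomogeneity \<open>f\<close>\<close>

lemma f_vec_carrier:
  "A \<in> carrier_mat n n \<Longrightarrow> B \<in> carrier_mat n 1 \<Longrightarrow> f_vec T A B F t \<in> carrier_vec (n * n)"
  by (auto simp: f_vec_def stack_vec_def Let_def)

text \<open>Block \<open>k\<close> involves derivatives of \<open>F\<close> of order below
  \<open>k\<close>, and \<open>k \<le> l\<close>, so one more differentiation stays within the
  \<open>l\<close> available orders.\<close>

lemma f_vec_deriv:
  assumes A: "A \<in> carrier_mat n n" and B: "B \<in> carrier_mat n 1"
    and F: "mat_C_k T l n n F" and n: "n = Suc l" and t: "t \<in> {0..T}" and T: "T > 0"
  shows "has_vec_deriv T (f_vec T A B F) (vec_deriv T (f_vec T A B F) t) t"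
proof -
  define g where "g i s = vec_of_cols ((mat_deriv T ^^ i) F s)" for i s
  define f' where "f' = stack_vec n n (\<lambda>k. vec n (\<lambda>r.
      - (\<Sum>i<k. (obs_block A B (k - 1 - i) *\<^sub>v g (Suc i) t) $ r)))"
  have g: "g i s \<in> carrier_vec (n * n)" if "s \<in> {0..T}" for i s
    unfolding g_def
    by (rule vec_of_cols_carrier[OF mat_deriv_funpow_carrier[where F = F, OF mat_C_k_carrier[OF F that]]])
  have "((\<lambda>s. f_vec T A B F s $ a) has_real_derivative f' $ a) (at t within {0..T})"
    if a: "a < n * n" for a
  proof -
    let ?k = "a div n" and ?r = "a mod n"
    note kr = block_index_div_mod[OF a]
    have "((\<lambda>s. - (\<Sum>i<?k. (obs_block A B (?k - 1 - i) *\<^sub>v g i s) $ ?r)) has_real_derivative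
        - (\<Sum>i<?k. (obs_block A B (?k - 1 - i) *\<^sub>v g (Suc i) t) $ ?r)) (at t within {0..T})"
    proof (intro DERIV_minus DERIV_sum has_real_derivative_mult_mat_vec[where p = n and q = "n * n"])
      fix i assume "i \<in> {..<?k}"
      then have "i < l" using kr(1) n by simp
      then show "has_vec_deriv T (g i) (g (Suc i) t) t"
        using mat_C_k_has_vec_deriv[OF F _ t] unfolding g_def by blast
    qed (use g t kr obs_block_carrier[OF A B] in auto)
    then show ?thesis
      using a A B kr by (simp add: f_vec_def f'_def stack_vec_def g_def)
  qed
  then have "has_vec_deriv T (f_vec T A B F) f' t"
    using f_vec_carrier[OF A B, of T F t]
    by (auto simp: has_vec_deriv_def f'_def stack_vec_def)
  \<comment> \<open>Uniqueness identifies the explicit \<open>f'\<close> with the value of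
    \<open>vec_deriv\<close>.\<close>
  then show ?thesis
    using has_vec_deriv_imp_vec_deriv[OF _ t T] by metis
qed

text \<open>Column stacking is linear and injective and respects derivatives in both directions, so
  nothing is lost in passing to vectors.\<close>

lemma solves_iff_vec:
  assumes A: "A \<in> carrier_mat n n" and B: "B \<in> carrier_mat n 1" and Q: "Q \<in> carrier_mat n n"
    and "\<forall>t\<in>{0..T}. F t \<in> carrier_mat n n" "\<forall>t\<in>{0..T}. Y t \<in> carrier_mat n n"
  defines "y \<equiv> \<lambda>t. vec_of_cols (Y t)"
  shows "solves T A B F Q Y \<longleftrightarrow> (\<forall>t\<in>{0..T}.
     has_vec_deriv T y (transpose_mat (A_tilde A) *\<^sub>v y t - vec_of_cols Q - vec_of_cols (F t)) t \<and>
     transpose_mat (B_tilde B) *\<^sub>v y t = 0\<^sub>v n)"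
proof -
  have F: "F t \<in> carrier_mat n n" and Y: "Y t \<in> carrier_mat n n" if "t \<in> {0..T}" for t
    using assms(4,5) that by auto
  have "has_mat_deriv T Y (- (transpose_mat A * Y t) - Y t * A - Q - F t) t \<longleftrightarrow>
     has_vec_deriv T y (transpose_mat (A_tilde A) *\<^sub>v y t - vec_of_cols Q - vec_of_cols (F t)) t"
    and "transpose_mat B * Y t = 0\<^sub>m 1 n \<longleftrightarrow> transpose_mat (B_tilde B) *\<^sub>v y t = 0\<^sub>v n"
    if t: "t \<in> {0..T}" for t
  proof -
    let ?L = "- (transpose_mat A * Y t) - Y t * A"
    have L: "?L \<in> carrier_mat n n"
      using A Y[OF t] by (intro minus_carrier_mat mult_carrier_mat[of _ n n])
    have "vec_of_cols (?L - Q - F t)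
        = transpose_mat (A_tilde A) *\<^sub>v y t - vec_of_cols Q - vec_of_cols (F t)"
      unfolding y_def transpose_A_tilde_mult_vec[OF A Y[OF t]]
        vec_of_cols_diff[OF minus_carrier_mat[OF Q] F[OF t]] vec_of_cols_diff[OF L Q] ..
    then show "has_mat_deriv T Y (?L - Q - F t) t \<longleftrightarrow>
       has_vec_deriv T y (transpose_mat (A_tilde A) *\<^sub>v y t - vec_of_cols Q - vec_of_cols (F t)) t"
      unfolding y_def
      using has_mat_deriv_iff_vec_of_cols[OF Y minus_carrier_mat[OF F[OF t]] t] by simp
    have BY: "transpose_mat B * Y t \<in> carrier_mat 1 n"
      using B Y[OF t] by (intro mult_carrier_mat[of _ 1 n]) auto
    show "transpose_mat B * Y t = 0\<^sub>m 1 n \<longleftrightarrow> transpose_mat (B_tilde B) *\<^sub>v y t = 0\<^sub>v n"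
      unfolding y_def transpose_B_tilde_mult_vec[OF B Y[OF t]]
      using vec_of_cols_inject[OF BY zero_carrier_mat] by (auto simp: vec_of_cols_zero)
  qed
  then show ?thesis
    using A B Y by (simp add: solves_def)
qed

text \<open>Row \<open>a\<close> lies in block \<open>a div n\<close>, which is at most
  \<open>l\<close>, and there the output derivative of that order is the claim. The minus signs
  built into \<open>N_mat\<close> and \<open>f_vec\<close> account for the sign on the
  right.\<close>

lemma solves_imp_H_mult:
  assumes A: "A \<in> carrier_mat n n" and B: "B \<in> carrier_mat n 1" and Q: "Q \<in> carrier_mat n n"
    and F: "mat_C_k T l n n F" and n: "n = Suc l" and T: "T > 0"
    and Y: "solves T A B F Q Y" and t: "t \<in> {0..T}"
  shows "H_mat A B *\<^sub>v vec_of_cols (Y t) = - (N_mat A B *\<^sub>v vec_of_cols Q + f_vec T A B F t)"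
proof -
  define g where "g i s = vec_of_cols ((mat_deriv T ^^ i) F s)" for i s
  define y where "y = (\<lambda>t. vec_of_cols (Y t))"
  let ?C = "transpose_mat (B_tilde B)" and ?M = "transpose_mat (A_tilde A)"
  have Yc: "Y s \<in> carrier_mat n n" if "s \<in> {0..T}" for s
    using Y A that by (auto simp: solves_def)
  note Fc = mat_C_k_carrier[OF F]
  have C: "?C \<in> carrier_mat n (n * n)" and M: "?M \<in> carrier_mat (n * n) (n * n)"
    and q: "vec_of_cols Q \<in> carrier_vec (n * n)"
    using A_tilde_carrier[OF A] B_tilde_carrier[OF B] vec_of_cols_carrier[OF Q] by auto
  have g: "g i s \<in> carrier_vec (n * n)" if "s \<in> {0..T}" for i s
    unfolding g_def by (rule vec_of_cols_carrier[OF mat_deriv_funpow_carrier[where F = F, OF Fc[OF that]]])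
  have g': "has_vec_deriv T (g i) (g (Suc i) s) s" if "i < l" "s \<in> {0..T}" for i s
    using mat_C_k_has_vec_deriv[OF F that] unfolding g_def .
  have y: "y s \<in> carrier_vec (n * n)" if "s \<in> {0..T}" for s
    unfolding y_def by (rule vec_of_cols_carrier[OF Yc[OF that]])
  have "\<forall>t\<in>{0..T}. F t \<in> carrier_mat n n" "\<forall>t\<in>{0..T}. Y t \<in> carrier_mat n n"
    using Fc Yc by blast+
  note iff = solves_iff_vec[OF A B Q this]
  have "has_vec_deriv T y (?M *\<^sub>v y s - vec_of_cols Q - g 0 s) s" "?C *\<^sub>v y s = 0\<^sub>v n"
    if "s \<in> {0..T}" for s
    using Y that unfolding iff by (simp_all add: g_def y_def)
  note out = output_derivatives[OF C M q T g g' y this _ t, where l = l]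
  show ?thesis
  proof (rule eq_vecI)
    fix a assume "a < dim_vec (- (N_mat A B *\<^sub>v vec_of_cols Q + f_vec T A B F t))"
    then have a: "a < n * n" using carrier_vecD[OF f_vec_carrier[OF A B]] by simp
    note kr = block_index_div_mod[OF a]
    have o: "(obs_block A B (a div n) *\<^sub>v y t) $ (a mod n)
      = (if a div n = 0 then 0 else (obs_block A B (a div n - 1) *\<^sub>v vec_of_cols Q) $ (a mod n))
      + (\<Sum>i<a div n. (obs_block A B (a div n - 1 - i) *\<^sub>v g i t) $ (a mod n))"
      unfolding obs_block_def by (rule out) (use kr n in auto)
    have "(H_mat A B *\<^sub>v y t) $ a = (obs_block A B (a div n) *\<^sub>v y t) $ (a mod n)"
      using a by (simp add: H_mat_mult_vec[OF A B y[OF t]] stack_vec_def)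
    moreover have "(N_mat A B *\<^sub>v vec_of_cols Q) $ a
      = - (if a div n = 0 then 0 else (obs_block A B (a div n - 1) *\<^sub>v vec_of_cols Q) $ (a mod n))"
      using a kr carrier_matD(1)[OF obs_block_carrier[OF A B]]
      by (auto simp: N_mat_mult_vec[OF A B q] stack_vec_def)
    moreover have "f_vec T A B F t $ a
      = - (\<Sum>i<a div n. (obs_block A B (a div n - 1 - i) *\<^sub>v g i t) $ (a mod n))"
      using a kr A B by (simp add: f_vec_def stack_vec_def g_def)
    moreover have "(- (N_mat A B *\<^sub>v vec_of_cols Q + f_vec T A B F t)) $ a
      = - ((N_mat A B *\<^sub>v vec_of_cols Q) $ a + f_vec T A B F t $ a)"
      using a carrier_vecD[OF f_vec_carrier[OF A B]] carrier_matD(1)[OF N_mat_carrier[OF A B]] by simp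
    ultimately show "(H_mat A B *\<^sub>v vec_of_cols (Y t)) $ a
        = (- (N_mat A B *\<^sub>v vec_of_cols Q + f_vec T A B F t)) $ a"
      using o by (simp add: y_def)
  qed (use carrier_matD(1)[OF H_mat_carrier[OF A B]] carrier_vecD[OF f_vec_carrier[OF A B]] in simp)
qed

section \<open>The equation for q\<close>

text \<open>The left side is the differential equation for the candidate
  \<open>- (Hi *\<^sub>v (N *\<^sub>v q + f))\<close>, whose derivative involves only
  \<open>f'\<close> because \<open>q\<close> is constant. Multiplying by the invertible
  \<open>H\<close> is reversible and removes the leading \<open>Hi\<close>.\<close>

lemma state_equation_iff:
  fixes H Hi M N :: "real mat"
  assumes H: "H \<in> carrier_mat d d" and Hi: "Hi \<in> carrier_mat d d" "H * Hi = 1\<^sub>m d" "Hi * H = 1\<^sub>m d"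
    and M: "M \<in> carrier_mat d d" and N: "N \<in> carrier_mat d d"
    and q: "q \<in> carrier_vec d" and f: "f \<in> carrier_vec d" and f': "f' \<in> carrier_vec d"
    and g: "g \<in> carrier_vec d"
  shows "- (Hi *\<^sub>v f') = M *\<^sub>v (- (Hi *\<^sub>v (N *\<^sub>v q + f))) - q - g \<longleftrightarrow>
    (H * M * Hi * N + H) *\<^sub>v q = - ((H * M * Hi) *\<^sub>v f) + f' - H *\<^sub>v g"
proof -
  define w where "w = Hi *\<^sub>v (N *\<^sub>v q + f)"
  have HM: "H * M \<in> carrier_mat d d" and HMHi: "H * M * Hi \<in> carrier_mat d d"
    and Nq: "N *\<^sub>v q \<in> carrier_vec d" and w: "w \<in> carrier_vec d" and Mw: "M *\<^sub>v w \<in> carrier_vec d"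
    and Hif': "Hi *\<^sub>v f' \<in> carrier_vec d"
    using assms by (auto simp: w_def)
  have inj: "v = v' \<longleftrightarrow> H *\<^sub>v v = H *\<^sub>v v'" if "v \<in> carrier_vec d" "v' \<in> carrier_vec d" for v v'
    using that assoc_mult_mat_vec[OF Hi(1) H] Hi(3) by (metis one_mult_mat_vec)
  have Hw: "H *\<^sub>v (M *\<^sub>v w) = (H * M * Hi * N) *\<^sub>v q + (H * M * Hi) *\<^sub>v f"
  proof -
    have "H *\<^sub>v (M *\<^sub>v w) = (H * M * Hi) *\<^sub>v (N *\<^sub>v q + f)"
      using assoc_mult_mat_vec[OF HM Hi(1) add_carrier_vec[OF Nq f]] assoc_mult_mat_vec[OF H M w]
      by (simp add: w_def)
    then show ?thesis
      using mult_add_distrib_mat_vec[OF HMHi Nq f] assoc_mult_mat_vec[OF HMHi N q] by simp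
  qed
  have neg: "X *\<^sub>v (- v) = - (X *\<^sub>v v)" if "X \<in> carrier_mat d d" "v \<in> carrier_vec d" for X and v :: "real vec"
    using that by (intro eq_vecI) auto
  have "H *\<^sub>v (- (Hi *\<^sub>v f')) = - f'"
    using assoc_mult_mat_vec[OF H Hi(1) f'] Hi(2) f' by (simp add: neg[OF H Hif'])
  moreover have "H *\<^sub>v (M *\<^sub>v (- w) - q - g)
      = - ((H * M * Hi * N) *\<^sub>v q + (H * M * Hi) *\<^sub>v f) - H *\<^sub>v q - H *\<^sub>v g"
    using mult_minus_distrib_mat_vec[OF H minus_carrier_vec[OF _ q] g, of "- (M *\<^sub>v w)"]
      mult_minus_distrib_mat_vec[OF H _ q, of "- (M *\<^sub>v w)"] Mw
    by (simp add: neg[OF M w] neg[OF H Mw] Hw)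
  moreover have "- f' = - ((H * M * Hi * N) *\<^sub>v q + (H * M * Hi) *\<^sub>v f) - H *\<^sub>v q - H *\<^sub>v g \<longleftrightarrow>
      (H * M * Hi * N) *\<^sub>v q + H *\<^sub>v q = - ((H * M * Hi) *\<^sub>v f) + f' - H *\<^sub>v g"
  proof -
    \<comment> \<open>The letters \<open>a\<close>, \<open>b\<close>, \<open>c\<close>,
      \<open>e\<close>, \<open>h\<close> stand for entries of the \<open>N\<close> term in
      \<open>q\<close>, the \<open>f\<close> term, \<open>H *\<^sub>v q\<close>, \<open>f'\<close>
      and \<open>H *\<^sub>v g\<close>.\<close>
    have arith: "- e = - a - b - c - h \<longleftrightarrow> a + c = e - b - h" for a b c e h :: real
      by linarith
    show ?thesis
      using H f' carrier_matD(1)[OF HMHi] carrier_matD(1)[OF mult_carrier_mat[OF HMHi N]]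
      by (simp add: vec_eq_iff arith del: index_mult_mat_vec)
  qed
  moreover have "(H * M * Hi * N + H) *\<^sub>v q = (H * M * Hi * N) *\<^sub>v q + H *\<^sub>v q"
    using mult_carrier_mat[OF HMHi N] H q by (rule add_mult_distrib_mat_vec)
  ultimately show ?thesis
    using inj[of "- (Hi *\<^sub>v f')" "M *\<^sub>v (- w) - q - g"] Hif' M w q g
    by (simp add: w_def)
qed

theorem theorem7:
  fixes n :: nat and T :: real and A B :: "real mat" and K :: "real \<Rightarrow> real mat"
  assumes "n \<ge> 1" and "T > 0"
    and "A \<in> carrier_mat n n" and "B \<in> carrier_mat n 1"
    and "controllable A B"
    and "\<forall>t\<in>{0..T}. K t \<in> carrier_mat 1 n"
    and "\<forall>t\<in>{0..T}. transpose_mat (K t * B) = K t * B"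
    and "\<forall>t\<in>{0..T}. mat_rank (K t * B) = mat_rank (K t)"
    and "mat_C_k T n n n (P0 B K)"
  shows "((\<exists>Q \<in> carrier_mat n n. \<exists>Y. solves T A B (G T A B K) Q Y)
           \<longleftrightarrow> (\<exists>q \<in> carrier_vec (n * n). q_equation T A B (G T A B K) q))
    \<and> (\<forall>q \<in> carrier_vec (n * n). q_equation T A B (G T A B K) q \<longrightarrow>
         (let Q = mat_of_vec n q;
              Y = (\<lambda>t. - mat_of_vec n
                    (mat_inv (H_mat A B) *\<^sub>v (N_mat A B *\<^sub>v q + f_vec T A B (G T A B K) t)))
          in solves T A B (G T A B K) Q Y
             \<and> (\<forall>Y'. solves T A B (G T A B K) Q Y' \<longrightarrow> (\<forall>t\<in>{0..T}. Y' t = Y t))))"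
proof -
  note T = \<open>T > 0\<close> and A = \<open>A \<in> carrier_mat n n\<close> and B = \<open>B \<in> carrier_mat n 1\<close>
  \<comment> \<open>\<open>l\<close> is both the order of smoothness left for \<open>F\<close> and
    the number of the last block of \<open>H\<close>.\<close>
  obtain l where n: "n = Suc l"
    using \<open>n \<ge> 1\<close> by (cases n) auto
  define F where "F = G T A B K"
  define H where "H = H_mat A B"
  define Hi where "Hi = mat_inv H"
  define N where "N = N_mat A B"
  define M where "M = transpose_mat (A_tilde A)"
  define f where "f = f_vec T A B F"
  \<comment> \<open>The only possible stacked solution for a given \<open>q\<close>, obtained by
    solving \<open>H y = - (N q + f)\<close>.\<close>
  define y where "y q t = - (Hi *\<^sub>v (N *\<^sub>v q + f t))" for q t
  have F: "mat_C_k T l n n F"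
    using mat_C_k_G[OF _ T A B] \<open>mat_C_k T n n n (P0 B K)\<close> unfolding F_def n by blast
  note Fc = mat_C_k_carrier[OF F]
  then have Fb: "\<forall>t\<in>{0..T}. F t \<in> carrier_mat n n"
    by blast
  have H: "H \<in> carrier_mat (n * n) (n * n)" and N: "N \<in> carrier_mat (n * n) (n * n)"
    and M: "M \<in> carrier_mat (n * n) (n * n)"
    using H_mat_carrier[OF A B] N_mat_carrier[OF A B] A_tilde_carrier[OF A]
    by (simp_all add: H_def N_def M_def)
  have Hi: "Hi \<in> carrier_mat (n * n) (n * n)" "H * Hi = 1\<^sub>m (n * n)" "Hi * H = 1\<^sub>m (n * n)"
    using mat_inv[OF H] det_H_mat[OF A B \<open>controllable A B\<close>] by (simp_all add: H_def Hi_def)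
  have f: "f t \<in> carrier_vec (n * n)" for t
    unfolding f_def using A B by (rule f_vec_carrier)
  have f': "has_vec_deriv T f (vec_deriv T f t) t" if "t \<in> {0..T}" for t
    unfolding f_def using A B F n that T by (rule f_vec_deriv)
  have f'c: "vec_deriv T f t \<in> carrier_vec (n * n)" for t
    using f[of t] by (simp add: vec_deriv_def)
  have Nqf: "N *\<^sub>v q + f t \<in> carrier_vec (n * n)" if "q \<in> carrier_vec (n * n)" for q t
    using mult_mat_vec_carrier[OF N that] f by simp
  have yc: "y q t \<in> carrier_vec (n * n)" if "q \<in> carrier_vec (n * n)" for q t
    unfolding y_def using mult_mat_vec_carrier[OF Hi(1) Nqf[OF that]] by simp
  have y': "has_vec_deriv T (y q) (- (Hi *\<^sub>v vec_deriv T f t)) t"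
    if q: "q \<in> carrier_vec (n * n)" and t: "t \<in> {0..T}" for q t
  proof -
    have "((\<lambda>s. (Hi *\<^sub>v (N *\<^sub>v q + f s)) $ a) has_real_derivative (Hi *\<^sub>v vec_deriv T f t) $ a)
        (at t within {0..T})" if "a < n * n" for a
    proof (rule has_real_derivative_mult_mat_vec[OF Hi(1) Nqf[OF q] _ t that])
      have "((\<lambda>s. (N *\<^sub>v q + f s) $ b) has_real_derivative vec_deriv T f t $ b) (at t within {0..T})"
        if b: "b < n * n" for b
      proof (rule has_real_derivative_within_cong)
        show "((\<lambda>s. (N *\<^sub>v q) $ b + f s $ b) has_real_derivative vec_deriv T f t $ b)
            (at t within {0..T})"
          using f'[OF t] b carrier_vecD[OF f'c[of t]]
          by (intro DERIV_add[OF DERIV_const, THEN DERIV_cong]) (auto simp: has_vec_deriv_def)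
        show "(N *\<^sub>v q + f s) $ b = (N *\<^sub>v q) $ b + f s $ b" for s
          using b carrier_vecD[OF f[of s]] by simp
      qed (fact t)
      then show "has_vec_deriv T (\<lambda>s. N *\<^sub>v q + f s) (vec_deriv T f t) t"
        using carrier_vecD[OF f[of t]] carrier_vecD[OF f'c[of t]] by (simp add: has_vec_deriv_def)
    qed
    then have "((\<lambda>s. - (Hi *\<^sub>v (N *\<^sub>v q + f s)) $ a) has_real_derivative
        - (Hi *\<^sub>v vec_deriv T f t) $ a) (at t within {0..T})" if "a < n * n" for a
      using that by (intro DERIV_minus)
    then show ?thesis
      using carrier_matD(1)[OF Hi(1)] by (simp add: has_vec_deriv_def y_def del: index_mult_mat_vec)
  qed
  \<comment> \<open>The derivative of \<open>y q\<close> is known from \<open>y'\<close>. By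
    uniqueness the differential equation is therefore an algebraic identity at each time, to which
    \<open>state_equation_iff\<close> applies.\<close>
  have q_eq: "q_equation T A B F q \<longleftrightarrow>
      (\<forall>t\<in>{0..T}. has_vec_deriv T (y q) (M *\<^sub>v y q t - q - vec_of_cols (F t)) t)"
    if q: "q \<in> carrier_vec (n * n)" for q
  proof -
    have "(H * M * Hi * N + H) *\<^sub>v q
          = - ((H * M * Hi) *\<^sub>v f t) + vec_deriv T f t - H *\<^sub>v vec_of_cols (F t) \<longleftrightarrow>
        has_vec_deriv T (y q) (M *\<^sub>v y q t - q - vec_of_cols (F t)) t"
      if t: "t \<in> {0..T}" for t
      unfolding state_equation_iff[OF H Hi M N q f f'c vec_of_cols_carrier[OF Fc[OF t]], symmetric]
      unfolding y_def[symmetric]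
      using y'[OF q t] has_vec_deriv_imp_vec_deriv[OF _ t T] by metis
    then show ?thesis
      unfolding q_equation_def Let_def
      by (simp add: H_def[symmetric] Hi_def[symmetric] N_def[symmetric] M_def[symmetric] f_def[symmetric])
  qed
  \<comment> \<open>Every solution is the candidate belonging to its \<open>Q\<close>; this serves
    both necessity and the uniqueness of \<open>Y\<close>.\<close>
  have fwd: "vec_of_cols (Y t) = y (vec_of_cols Q) t"
    if Q: "Q \<in> carrier_mat n n" and Y: "solves T A B F Q Y" and t: "t \<in> {0..T}" for Q Y t
  proof -
    have Yt: "vec_of_cols (Y t) \<in> carrier_vec (n * n)"
      using Y t A by (intro vec_of_cols_carrier) (auto simp: solves_def)
    have "H *\<^sub>v vec_of_cols (Y t) = - (N *\<^sub>v vec_of_cols Q + f t)"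
      using solves_imp_H_mult[OF A B Q F n T Y t] by (simp add: H_def N_def f_def)
    then have "vec_of_cols (Y t) = Hi *\<^sub>v (- (N *\<^sub>v vec_of_cols Q + f t))"
      using assoc_mult_mat_vec[OF Hi(1) H Yt] Hi(3) Yt by simp
    also have "\<dots> = y (vec_of_cols Q) t"
      using Hi(1) carrier_vecD[OF Nqf[OF vec_of_cols_carrier[OF Q]]]
      unfolding y_def by (intro eq_vecI) auto
    finally show ?thesis .
  qed
  have only_if: "q_equation T A B F (vec_of_cols Q)"
    if Q: "Q \<in> carrier_mat n n" and Y: "solves T A B F Q Y" for Q Y
  proof -
    have "\<forall>t\<in>{0..T}. Y t \<in> carrier_mat n n"
      using Y A by (auto simp: solves_def)
    note iff = solves_iff_vec[OF A B Q Fb this]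
    have "has_vec_deriv T (y (vec_of_cols Q)) (M *\<^sub>v y (vec_of_cols Q) t - vec_of_cols Q - vec_of_cols (F t)) t"
      if t: "t \<in> {0..T}" for t
    \<comment> \<open>The stacked \<open>Y\<close> equals the candidate on all of
      \<open>{0..T}\<close>, so its derivative carries over.\<close>
    proof (rule has_vec_deriv_cong)
      show "has_vec_deriv T (\<lambda>s. vec_of_cols (Y s))
          (M *\<^sub>v y (vec_of_cols Q) t - vec_of_cols Q - vec_of_cols (F t)) t"
        using bspec[OF Y[unfolded iff] t] by (simp add: fwd[OF Q Y t] M_def)
    qed (use t fwd[OF Q Y] in simp_all)
    then show ?thesis
      using q_eq[OF vec_of_cols_carrier[OF Q]] by blast
  qed
  have sol: "solves T A B F (mat_of_vec n q) (\<lambda>t. - mat_of_vec n (Hi *\<^sub>v (N *\<^sub>v q + f t)))"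
    (is "solves _ _ _ _ _ ?Y")
    if q: "q \<in> carrier_vec (n * n)" and eq: "q_equation T A B F q" for q
  proof -
    have Y: "\<forall>t\<in>{0..T}. ?Y t \<in> carrier_mat n n"
      using mat_of_vec_carrier by simp
    have Yy: "vec_of_cols (?Y t) = y q t" for t
      using vec_of_cols_mat_of_vec[OF mult_mat_vec_carrier[OF Hi(1) Nqf[OF q]]]
      by (simp add: vec_of_cols_uminus y_def)
    \<comment> \<open>\<open>obs_block A B 0\<close> is the transpose of \<open>B_tilde B\<close>,
      and block 0 of \<open>N\<close> and of \<open>f\<close> vanishes.\<close>
    have "transpose_mat (B_tilde B) *\<^sub>v y q t = 0\<^sub>v n" for t
    proof (rule eq_vecI)
      let ?z = "N *\<^sub>v q + f t"
      have "H *\<^sub>v y q t = - (H *\<^sub>v (Hi *\<^sub>v ?z))"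
        using H Hi(1) unfolding y_def by (intro eq_vecI) auto
      then have Hy: "H *\<^sub>v y q t = - ?z"
        using assoc_mult_mat_vec[OF H Hi(1) Nqf[OF q]] Hi(2) Nqf[OF q] by simp
      have Bt: "transpose_mat (B_tilde B) \<in> carrier_mat n (n * n)"
        using B_tilde_carrier[OF B] by simp
      fix r assume "r < dim_vec (0\<^sub>v n :: real vec)"
      then have r: "r < n" by simp
      \<comment> \<open>As \<open>n\<close> is positive, \<open>r\<close> is also a row number of
        \<open>H\<close>, and that row lies in block 0.\<close>
      then have rn: "r < n * n" using n by (simp add: trans_less_add1)
      have "(transpose_mat (B_tilde B) *\<^sub>v y q t) $ r = (H *\<^sub>v y q t) $ r"
        unfolding H_def H_mat_mult_vec[OF A B yc[OF q]]
        using r rn A_tilde_carrier[OF A] right_mult_one_mat[OF Bt]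
        by (simp add: stack_vec_def obs_block_def)
      also have "\<dots> = - ((N *\<^sub>v q) $ r + f t $ r)"
        unfolding Hy using rn carrier_matD(1)[OF N] carrier_vecD[OF f[of t]] by simp
      also have "\<dots> = 0"
        unfolding N_def N_mat_mult_vec[OF A B q] using r rn A B
        by (simp add: stack_vec_def f_def f_vec_def)
      finally show "(transpose_mat (B_tilde B) *\<^sub>v y q t) $ r = 0\<^sub>v n $ r"
        using r by simp
    qed (use B_tilde_carrier[OF B] in simp)
    with eq show ?thesis
      unfolding q_eq[OF q] solves_iff_vec[OF A B mat_of_vec_carrier Fb Y]
        Yy vec_of_cols_mat_of_vec[OF q] M_def by blast
  qed
  have uniq: "Y' t = - mat_of_vec n (Hi *\<^sub>v (N *\<^sub>v q + f t))"
    if q: "q \<in> carrier_vec (n * n)" and Y': "solves T A B F (mat_of_vec n q) Y'" and t: "t \<in> {0..T}"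
    for q Y' t
  proof (rule vec_of_cols_inject)
    show "Y' t \<in> carrier_mat n n"
      using Y' A t by (auto simp: solves_def)
    show "- mat_of_vec n (Hi *\<^sub>v (N *\<^sub>v q + f t)) \<in> carrier_mat n n"
      using mat_of_vec_carrier by simp
    show "vec_of_cols (Y' t) = vec_of_cols (- mat_of_vec n (Hi *\<^sub>v (N *\<^sub>v q + f t)))"
      using fwd[OF mat_of_vec_carrier Y' t]
        vec_of_cols_mat_of_vec[OF mult_mat_vec_carrier[OF Hi(1) Nqf[OF q]]]
      by (simp add: vec_of_cols_mat_of_vec[OF q] vec_of_cols_uminus y_def)
  qed
  \<comment> \<open>The witnesses are \<open>vec_of_cols Q\<close> in one direction and
    \<open>mat_of_vec n q\<close> in the other.\<close>
  have "(\<exists>Q \<in> carrier_mat n n. \<exists>Y. solves T A B F Q Y)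
      \<longleftrightarrow> (\<exists>q \<in> carrier_vec (n * n). q_equation T A B F q)"
    using only_if vec_of_cols_carrier sol mat_of_vec_carrier by metis
  with sol uniq show ?thesis
    unfolding Let_def F_def[symmetric] f_def[symmetric] N_def[symmetric] H_def[symmetric]
      Hi_def[symmetric] by blast
qed

end
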